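(* Let $d\ge1$, $1\le p<\infty$, and let $\nu:\mathbb{R}^d\setminus\{0\}\to[0,\infty)$ be measurable with $\int_{\mathbb{R}^d}(1\wedge|h|^p)\,\nu(h)\,dh<\infty$. Let $w(r)=(r\,\nu^\#(r))^{1/p}$ be the potential associated with $\nu$ (see context). Assume that $r\mapsto w(r)$ is invertible from $[0,\infty)$ to $[0,\infty)$, that $t\mapsto\phi(t^{1/p})$ is a Young function, where $\phi(t)=1/w^{-1}(1/t)$, and that there is $\theta>0$ such that $\phi(\theta s/t)\le\phi(s)/\phi(t)$ for all $0\le s\le t$, $t>0$. Let $\psi$ be a Young function such that, for some constant $c>0$, $\psi(ct)\le\max(t^p,\phi(t))$ for all $t>0$. Then the embeddings $W^p_\nu(\mathbb{R}^d)\hookrightarrow L^\psi(\mathbb{R}^d)$ and $W^{1,p}(\mathbb{R}^d)\hookrightarrow L^\psi(\mathbb{R}^d)$ are continuous.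
   Context: $a\wedge b=\min(a,b)$; $|E|$ is Lebesgue measure, $c_d=|B(0,1)|$, $\eta(r)=(r/c_d)^{1/d}$. The symmetric decreasing rearrangement of $\nu$ is the radial function $\nu^*(\rho)=\inf\{s>0:|\{\nu>s\}|\le c_d\rho^d\}$, $\rho\ge0$. Define $\nu^\#(r)=\int_{\{\nu<\nu^*(\eta(r))\}}\nu(h)\,dh$, $w(r)=(r\,\nu^\#(r))^{1/p}$ for $r>0$, $w(0)=0$, and $\phi(t)=1/w^{-1}(1/t)$ for $t>0$, $\phi(0)=0$. A Young function is a convex function $\psi:[0,\infty]\to[0,\infty]$ with $\psi(0)=0$, not identically $0$ and not identically $\infty$ on $(0,\infty)$. $L^\psi(\mathbb{R}^d)$ is the Orlicz space of measurable $u$ with $\int\psi(|u|/\lambda)\,dx<\infty$ for some $\lambda>0$, with Luxemburg norm $\|u\|_{L^\psi}=\inf\{\lambda>0:\int\psi(|u|/\lambda)\,dx\le1\}$. $W^p_\nu(\mathbb{R}^d)=\{u\in L^p(\mathbb{R}^d):|u|_{W^p_\nu}<\infty\}$ with $|u|^p_{W^p_\nu}=\int_{\mathbb{R}^d}\int_{\mathbb{R}^d}|u(x)-u(y)|^p\nu(x-y)\,dy\,dx$ and norm $(\|u\|^p_{L^p}+|u|^p_{W^p_\nu})^{1/p}$. $W^{1,p}(\mathbb{R}^d)$ is the classical Sobolev space. *)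

theory Defs
  imports "HOL-Analysis.Analysis"
begin

text \<open>
  \<open>\<real>\<^sup>d\<close> is a type \<open>'a::euclidean_space\<close> with \<open>d = DIM('a)\<close> (so \<open>d \<ge> 1\<close>). Functions are real-valued,
  measurability is Lebesgue measurability, and elements of the function spaces are functions rather
  than classes of a.e. equal functions. A kernel \<open>\<nu>\<close> on \<open>\<real>\<^sup>d - {0}\<close> is a total function
  whose value at \<open>0\<close> is never used.
\<close>

definition unit_ball_measure :: "'a::euclidean_space itself \<Rightarrow> real" where
  "unit_ball_measure _ = measure lebesgue (ball (0::'a) 1)"

definition eta :: "'a::euclidean_space itself \<Rightarrow> real \<Rightarrow> real" where
  "eta T r = (r / unit_ball_measure T) powr (1 / real DIM('a))"

text \<open>Extended-real valued, with \<open>inf {} = \<infinity>\<close>: for unbounded \<open>\<nu>\<close> the value at \<open>\<rho> = 0\<close> may be infinite.\<close>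

definition nu_star :: "('a::euclidean_space \<Rightarrow> real) \<Rightarrow> real \<Rightarrow> ennreal" where
  "nu_star \<nu> \<rho> = Inf {ennreal s | s. 0 < s \<and>
     emeasure lebesgue {h. h \<noteq> 0 \<and> \<nu> h > s} \<le> ennreal (unit_ball_measure TYPE('a) * \<rho> ^ DIM('a))}"

definition nu_sharp :: "('a::euclidean_space \<Rightarrow> real) \<Rightarrow> real \<Rightarrow> ennreal" where
  "nu_sharp \<nu> r = (\<integral>\<^sup>+h\<in>{h. h \<noteq> 0 \<and> ennreal (\<nu> h) < nu_star \<nu> (eta TYPE('a) r)}. ennreal (\<nu> h) \<partial>lebesgue)"

text \<open>
  If \<open>(1 \<and> |h|\<^sup>p) \<nu>(h)\<close> is integrable and \<open>r > 0\<close>, then \<open>nu_star \<nu> (eta r)\<close> is finite, hence so is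
  \<open>nu_sharp \<nu> r\<close>, and nothing is lost by the conversion to \<open>real\<close>.
\<close>

definition potential :: "real \<Rightarrow> ('a::euclidean_space \<Rightarrow> real) \<Rightarrow> real \<Rightarrow> real" where
  "potential p \<nu> r = (if r > 0 then (r * enn2real (nu_sharp \<nu> r)) powr (1 / p) else 0)"

definition phi :: "real \<Rightarrow> ('a::euclidean_space \<Rightarrow> real) \<Rightarrow> real \<Rightarrow> real" where
  "phi p \<nu> t = (if t > 0 then 1 / the_inv_into {0..} (potential p \<nu>) (1 / t) else 0)"

definition young_function :: "(ennreal \<Rightarrow> ennreal) \<Rightarrow> bool" where
  "young_function \<psi> \<longleftrightarrow>
     (\<forall>x y a. 0 \<le> a \<and> a \<le> 1 \<longrightarrow>
        \<psi> (ennreal a * x + ennreal (1 - a) * y) \<le> ennreal a * \<psi> x + ennreal (1 - a) * \<psi> y) \<and>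
     \<psi> 0 = 0 \<and>
     (\<exists>t. 0 < t \<and> t < top \<and> \<psi> t \<noteq> 0) \<and>
     (\<exists>t. 0 < t \<and> t < top \<and> \<psi> t \<noteq> top)"

text \<open>
  Extends a function on \<open>[0,\<infinity>)\<close> to \<open>[0,\<infinity>]\<close> by the value \<open>\<infinity>\<close> at \<open>\<infinity>\<close>. For \<open>phi\<close> this is the value
  given by its formula, \<open>1 / w\<^sup>-\<^sup>1(1/\<infinity>) = 1 / w\<^sup>-\<^sup>1(0) = 1 / 0 = \<infinity>\<close>.
\<close>

definition extend_top :: "(real \<Rightarrow> real) \<Rightarrow> ennreal \<Rightarrow> ennreal" where
  "extend_top f t = (if t = top then top else ennreal (f (enn2real t)))"

definition orlicz_space :: "(ennreal \<Rightarrow> ennreal) \<Rightarrow> ('a::euclidean_space \<Rightarrow> real) set" where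
  "orlicz_space \<psi> = {u. u \<in> borel_measurable lebesgue \<and>
     (\<exists>l>0. (\<integral>\<^sup>+x. \<psi> (ennreal (\<bar>u x\<bar> / l)) \<partial>lebesgue) < top)}"

definition luxemburg_norm :: "(ennreal \<Rightarrow> ennreal) \<Rightarrow> ('a::euclidean_space \<Rightarrow> real) \<Rightarrow> real" where
  "luxemburg_norm \<psi> u = Inf {l. 0 < l \<and> (\<integral>\<^sup>+x. \<psi> (ennreal (\<bar>u x\<bar> / l)) \<partial>lebesgue) \<le> 1}"

definition Lp_power :: "real \<Rightarrow> ('a::euclidean_space \<Rightarrow> 'b::euclidean_space) \<Rightarrow> ennreal" where
  "Lp_power p u = (\<integral>\<^sup>+x. ennreal (norm (u x) powr p) \<partial>lebesgue)"

definition Lp_space :: "real \<Rightarrow> ('a::euclidean_space \<Rightarrow> 'b::euclidean_space) set" where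
  "Lp_space p = {u. u \<in> borel_measurable lebesgue \<and> Lp_power p u < top}"

definition nonlocal_power :: "real \<Rightarrow> ('a::euclidean_space \<Rightarrow> real) \<Rightarrow> ('a \<Rightarrow> real) \<Rightarrow> ennreal" where
  "nonlocal_power p \<nu> u =
     (\<integral>\<^sup>+x. (\<integral>\<^sup>+y. ennreal (\<bar>u x - u y\<bar> powr p * \<nu> (x - y)) \<partial>lebesgue) \<partial>lebesgue)"

definition nonlocal_space :: "real \<Rightarrow> ('a::euclidean_space \<Rightarrow> real) \<Rightarrow> ('a \<Rightarrow> real) set" where
  "nonlocal_space p \<nu> = {u \<in> Lp_space p. nonlocal_power p \<nu> u < top}"

definition nonlocal_norm :: "real \<Rightarrow> ('a::euclidean_space \<Rightarrow> real) \<Rightarrow> ('a \<Rightarrow> real) \<Rightarrow> real" where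
  "nonlocal_norm p \<nu> u = enn2real (Lp_power p u + nonlocal_power p \<nu> u) powr (1 / p)"

primrec C_k :: "nat \<Rightarrow> ('a::euclidean_space \<Rightarrow> real) \<Rightarrow> bool" where
  "C_k 0 f \<longleftrightarrow> continuous_on UNIV f"
| "C_k (Suc k) f \<longleftrightarrow> (\<forall>x. f differentiable (at x)) \<and>
     (\<forall>i\<in>Basis. C_k k (\<lambda>x. frechet_derivative f (at x) i))"

definition test_function :: "('a::euclidean_space \<Rightarrow> real) \<Rightarrow> bool" where
  "test_function f \<longleftrightarrow> (\<forall>k. C_k k f) \<and> compact (closure {x. f x \<noteq> 0})"

definition locally_integrable :: "('a::euclidean_space \<Rightarrow> 'b::euclidean_space) \<Rightarrow> bool" where
  "locally_integrable f \<longleftrightarrow> (\<forall>K. compact K \<longrightarrow> integrable (lebesgue_on K) f)"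

definition is_weak_gradient :: "('a::euclidean_space \<Rightarrow> real) \<Rightarrow> ('a \<Rightarrow> 'a) \<Rightarrow> bool" where
  "is_weak_gradient u g \<longleftrightarrow> locally_integrable u \<and> locally_integrable g \<and>
     (\<forall>f. test_function f \<longrightarrow> (\<forall>i\<in>Basis.
        (LINT x|lebesgue. u x * frechet_derivative f (at x) i) =
        - (LINT x|lebesgue. (g x \<bullet> i) * f x)))"

definition sobolev_space :: "real \<Rightarrow> ('a::euclidean_space \<Rightarrow> real) set" where
  "sobolev_space p = {u \<in> Lp_space p. \<exists>g \<in> Lp_space p. is_weak_gradient u g}"

text \<open>The weak gradient is unique up to null sets, so the norm does not depend on the choice.\<close>

definition weak_gradient :: "real \<Rightarrow> ('a::euclidean_space \<Rightarrow> real) \<Rightarrow> 'a \<Rightarrow> 'a" where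
  "weak_gradient p u = (SOME g. g \<in> Lp_space p \<and> is_weak_gradient u g)"

definition sobolev_norm :: "real \<Rightarrow> ('a::euclidean_space \<Rightarrow> real) \<Rightarrow> real" where
  "sobolev_norm p u = enn2real (Lp_power p u + Lp_power p (weak_gradient p u)) powr (1 / p)"

text \<open>The inclusion is linear, so its continuity means boundedness.\<close>

definition continuous_embedding :: "'f set \<Rightarrow> ('f \<Rightarrow> real) \<Rightarrow> 'f set \<Rightarrow> ('f \<Rightarrow> real) \<Rightarrow> bool" where
  "continuous_embedding X norm\<^sub>X Y norm\<^sub>Y \<longleftrightarrow> X \<subseteq> Y \<and> (\<exists>C. \<forall>u\<in>X. norm\<^sub>Y u \<le> C * norm\<^sub>X u)"

end

theory Submission
  imports Defs
begin

text \<open>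
  For \<open>u\<close> with \<open>\<integral> \<phi>(|u|/\<lambda>) \<le> 1\<close> and a point \<open>x\<close>, Chebyshev bounds the measure of \<open>E = {|u| > |u(x)|/2}\<close> by
  \<open>r = 1/\<phi>(|u(x)|/2\<lambda>)\<close>. Off \<open>E\<close> one has \<open>|u(x) - u(y)| \<ge> |u(x)|/2\<close>, and the integral of \<open>\<nu>(x - y)\<close> over the
  complement of a set of measure at most \<open>r\<close> is at least \<open>\<nu>\<^sup>#(r)\<close>; the relation between \<open>\<phi>\<close> and \<open>w\<close> turns
  this into \<open>\<integral> |u(x) - u(y)|\<^sup>p \<nu>(x - y) dy \<ge> \<lambda>\<^sup>p \<phi>(|u(x)|/2\<lambda>)\<close>. Integrating in \<open>x\<close> bounds
  \<open>\<lambda>\<^sup>p \<integral> \<phi>(|u|/2\<lambda>)\<close> by the seminorm. The submultiplicativity hypothesis makes \<open>\<phi>\<close> doubling, so that for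
  truncations of \<open>u\<close> some \<open>\<lambda>\<close> with \<open>\<integral> \<phi>(|u|/\<lambda>) \<le> 1\<close> also has \<open>\<integral> \<phi>(|u|/2\<lambda>)\<close> bounded below, whence
  \<open>\<lambda>\<close> is controlled by the seminorm; Fatou removes the truncation.

  For \<open>W\<^sup>1\<^sup>,\<^sup>p\<close> the difference quotient bound \<open>\<parallel>u(\<cdot> + h) - u\<parallel>\<^sub>p \<le> |h| \<parallel>\<nabla>u\<parallel>\<^sub>p\<close> is obtained by testing the
  weak gradient with smooth bumps increasing to indicators of boxes, which identifies
  \<open>u(x + h) - u(x)\<close> with \<open>\<integral>\<^sub>0\<^sup>1 \<nabla>u(x + sh) \<cdot> h ds\<close> almost everywhere.
\<close>

subsection \<open>Rearrangement of the kernel\<close>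

lemma sets_lebesgue_Collect: "Measurable.pred lebesgue P \<Longrightarrow> {x. P x} \<in> sets lebesgue"
  by (simp add: pred_def)

lemma borel_measurable_ident_lebesgue:
  "(\<lambda>x. x) \<in> borel_measurable (lebesgue :: 'a::euclidean_space measure)"
  by (rule measurable_completion) simp

lemma sets_lebesgue_Collect_nonzero:
  assumes "Measurable.pred lebesgue P"
  shows "{x::'a::euclidean_space. x \<noteq> 0 \<and> P x} \<in> sets lebesgue"
proof -
  have "{x. x \<noteq> 0 \<and> P x} = {x. P x} - {0::'a}" by auto
  with sets_lebesgue_Collect[OF assms] show ?thesis by (simp only:) (intro sets.Diff, auto)
qed

lemma unit_ball_measure_pos: "unit_ball_measure TYPE('a::euclidean_space) > 0"
  unfolding unit_ball_measure_def by (simp add: content_ball_pos)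

text \<open>\<open>eta\<close> gives the radius of the ball of volume \<open>r\<close>, so the
  measure bound in \<open>nu_star\<close> at this radius is \<open>r\<close> itself.\<close>

lemma unit_ball_eta_power:
  assumes "r > 0"
  shows "unit_ball_measure TYPE('a::euclidean_space) * eta TYPE('a) r ^ DIM('a) = r"
proof -
  let ?c = "unit_ball_measure TYPE('a)"
  have "eta TYPE('a) r ^ DIM('a) = (r / ?c) powr (1 / real DIM('a) * real DIM('a))"
    using assms unit_ball_measure_pos[where 'a='a] unfolding eta_def
    by (subst powr_realpow[symmetric]) (simp_all add: powr_powr)
  then show ?thesis using assms unit_ball_measure_pos[where 'a='a] by simp
qed

text \<open>A level \<open>s\<close> strictly between 0 and the value of \<open>nu_star\<close>
  fails the condition of the infimum, so the set where \<nu> exceeds \<open>s\<close> has measure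
  greater than \<open>r\<close>. The set with non-strict inequality is the decreasing limit of these
  sets as \<open>s\<close> increases, and their finite measure permits continuity from
  above.\<close>

lemma le_emeasure_superlevel_nu_star:
  fixes \<nu> :: "'a::euclidean_space \<Rightarrow> real"
  assumes [measurable]: "\<nu> \<in> borel_measurable lebesgue" and "\<And>h. 0 \<le> \<nu> h"
    and fin: "\<And>s. s > 0 \<Longrightarrow> emeasure lebesgue {h. h \<noteq> 0 \<and> \<nu> h > s} < top"
    and "r > 0" and pos: "nu_star \<nu> (eta TYPE('a) r) > 0"
  shows "ennreal r \<le> emeasure lebesgue {h. h \<noteq> 0 \<and> nu_star \<nu> (eta TYPE('a) r) \<le> ennreal (\<nu> h)}"
proof -
  let ?t = "nu_star \<nu> (eta TYPE('a) r)"
  let ?S = "\<lambda>s. {h. h \<noteq> 0 \<and> ennreal (\<nu> h) > s}"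
  have [measurable]: "?S s \<in> sets lebesgue" for s
    by (rule sets_lebesgue_Collect_nonzero) measurable
  have S: "?S (ennreal s) = {h. h \<noteq> 0 \<and> \<nu> h > s}" if "s \<ge> 0" for s
    using that by (auto simp: ennreal_less_iff)
  \<comment> \<open>Continuity from above needs countably many levels. An increasing sequence with
    supremum \<open>?t\<close> also covers a value of \<open>nu_star\<close> that is a priori
    infinite.\<close>
  have ne: "{s. 0 < s \<and> s < ?t} \<noteq> {}"
    using pos dense by blast
  have sup: "Sup {s. 0 < s \<and> s < ?t} = ?t"
    using pos cSup_greaterThanLessThan[of 0 ?t] by (simp add: greaterThanLessThan_def greaterThan_def lessThan_def Collect_conj_eq)
  from ennreal_Sup_countable_SUP[OF ne] obtain f where f: "incseq f" "range f \<subseteq> {s. 0 < s \<and> s < ?t}" "?t = (SUP i. f i)"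
    unfolding sup by blast
  have fi: "0 < f i" "f i < ?t" "f i < top" for i
    using f(2) less_le_trans[of "f i" ?t top] by auto
  have big: "ennreal r < emeasure lebesgue (?S (f i))" and finite: "emeasure lebesgue (?S (f i)) < top" for i
  proof -
    obtain s where s: "f i = ennreal s" "s > 0"
      using fi[of i] by (cases "f i") (auto simp: ennreal_less_zero_iff)
    have "\<not> emeasure lebesgue {h. h \<noteq> 0 \<and> \<nu> h > s} \<le> ennreal r"
    proof
      assume "emeasure lebesgue {h. h \<noteq> 0 \<and> \<nu> h > s} \<le> ennreal r"
      then have "?t \<le> ennreal s"
        unfolding nu_star_def using s unit_ball_eta_power[OF \<open>r > 0\<close>, where 'a='a] by (intro Inf_lower) auto
      then show False using fi(2)[of i] s by simp
    qed
    then show "ennreal r < emeasure lebesgue (?S (f i))" using S s by auto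
    show "emeasure lebesgue (?S (f i)) < top" using S s fin by auto
  qed
  have "(INF i. emeasure lebesgue (?S (f i))) = emeasure lebesgue (\<Inter>i. ?S (f i))"
  proof (rule INF_emeasure_decseq)
    show "decseq (\<lambda>i. ?S (f i))"
      using f(1) by (fastforce simp: decseq_def incseq_def dest: le_less_trans)
    show "emeasure lebesgue (?S (f i)) \<noteq> \<infinity>" for i
      using finite[of i] by (simp only: infinity_ennreal_def less_top)
  qed auto
  moreover have "(\<Inter>i. ?S (f i)) \<subseteq> {h. h \<noteq> 0 \<and> ?t \<le> ennreal (\<nu> h)}"
    unfolding f(3) by (auto intro!: SUP_least intro: less_imp_le)
  then have "emeasure lebesgue (\<Inter>i. ?S (f i)) \<le> emeasure lebesgue {h. h \<noteq> 0 \<and> ?t \<le> ennreal (\<nu> h)}"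
    by (rule emeasure_mono) (rule sets_lebesgue_Collect_nonzero, measurable)
  moreover have "ennreal r \<le> (INF i. emeasure lebesgue (?S (f i)))"
    using big by (intro INF_greatest less_imp_le)
  ultimately show ?thesis by simp
qed

text \<open>Bathtub principle: among sets of measure at most \<open>r\<close>, removing the largest
  values of \<nu> leaves the least integral. With \<open>t\<close> the threshold, \<nu> is below
  \<open>t\<close> on \<open>A\<close> and at least \<open>t\<close> on \<open>B\<close>. Since
  \<open>B\<close> has measure at least \<open>r\<close>, what \<open>F\<close> removes from
  \<open>A\<close> is no larger than what it leaves of \<open>B\<close>, and there \<nu> is at least
  as large.\<close>

lemma nu_sharp_le_integral_Compl:
  fixes \<nu> :: "'a::euclidean_space \<Rightarrow> real"
  assumes [measurable]: "\<nu> \<in> borel_measurable lebesgue" and "\<And>h. 0 \<le> \<nu> h"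
    and fin: "\<And>s. s > 0 \<Longrightarrow> emeasure lebesgue {h. h \<noteq> 0 \<and> \<nu> h > s} < top"
    and "r > 0" and F[measurable]: "F \<in> sets lebesgue" and Fr: "emeasure lebesgue F \<le> ennreal r"
  shows "nu_sharp \<nu> r \<le> (\<integral>\<^sup>+h\<in>-F. ennreal (\<nu> h) \<partial>lebesgue)"
proof -
  define t where "t = nu_star \<nu> (eta TYPE('a) r)"
  define A where "A = {h. h \<noteq> 0 \<and> ennreal (\<nu> h) < t}"
  define B where "B = {h. h \<noteq> 0 \<and> t \<le> ennreal (\<nu> h)}"
  have [measurable]: "A \<in> sets lebesgue" "B \<in> sets lebesgue"
    unfolding A_def B_def by (rule sets_lebesgue_Collect_nonzero, measurable)+
  show ?thesis
  proof (cases "t = 0")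
    case True
    then show ?thesis by (simp add: nu_sharp_def t_def)
  next
    case False
    then have rB: "ennreal r \<le> emeasure lebesgue B"
      unfolding B_def t_def using assms by (intro le_emeasure_superlevel_nu_star) (auto simp: t_def zero_less_iff_neq_zero)
    have "emeasure lebesgue (A \<inter> F) + emeasure lebesgue (B \<inter> F) = emeasure lebesgue ((A \<inter> F) \<union> (B \<inter> F))"
    proof (rule plus_emeasure)
      show "A \<inter> F \<inter> (B \<inter> F) = {}" by (auto simp: A_def B_def)
    qed measurable
    also have "\<dots> \<le> emeasure lebesgue F" by (intro emeasure_mono) auto
    also have "\<dots> \<le> emeasure lebesgue B" using Fr rB by simp
    also have "\<dots> = emeasure lebesgue ((B - F) \<union> (B \<inter> F))" by (rule arg_cong[where f="emeasure lebesgue"]) auto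
    also have "\<dots> = emeasure lebesgue (B - F) + emeasure lebesgue (B \<inter> F)"
      by (intro plus_emeasure[symmetric]) auto
    finally have *: "emeasure lebesgue (A \<inter> F) + emeasure lebesgue (B \<inter> F) \<le> emeasure lebesgue (B - F) + emeasure lebesgue (B \<inter> F)" .
    \<comment> \<open>The common part \<open>B \<inter> F\<close> can be cancelled only because its
      measure is finite, which it inherits from \<open>F\<close>.\<close>
    have "emeasure lebesgue (B \<inter> F) \<le> emeasure lebesgue F" by (intro emeasure_mono) auto
    then have "emeasure lebesgue (B \<inter> F) \<noteq> top" using Fr by (auto simp: top_unique)
    then have AB: "emeasure lebesgue (A \<inter> F) \<le> emeasure lebesgue (B - F)"
      using * ennreal_add_left_cancel_le by (simp only: add.commute[of _ "emeasure lebesgue (B \<inter> F)"] infinity_ennreal_def) blast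
    have "nu_sharp \<nu> r = (\<integral>\<^sup>+h\<in>A. ennreal (\<nu> h) \<partial>lebesgue)"
      by (simp add: nu_sharp_def A_def t_def)
    also have "\<dots> = (\<integral>\<^sup>+h. ennreal (\<nu> h) * indicator (A \<inter> F) h + ennreal (\<nu> h) * indicator (A - F) h \<partial>lebesgue)"
      by (intro nn_integral_cong) (auto split: split_indicator)
    also have "\<dots> = (\<integral>\<^sup>+h\<in>A \<inter> F. ennreal (\<nu> h) \<partial>lebesgue) + (\<integral>\<^sup>+h\<in>A - F. ennreal (\<nu> h) \<partial>lebesgue)"
      by (intro nn_integral_add) measurable
    also have "(\<integral>\<^sup>+h\<in>A \<inter> F. ennreal (\<nu> h) \<partial>lebesgue) \<le> (\<integral>\<^sup>+h. t * indicator (A \<inter> F) h \<partial>lebesgue)"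
      by (intro nn_integral_mono) (auto simp: A_def split: split_indicator)
    also have "\<dots> = t * emeasure lebesgue (A \<inter> F)" by (simp add: nn_integral_cmult_indicator)
    also have "\<dots> \<le> t * emeasure lebesgue (B - F)" using AB by (rule mult_left_mono) simp
    also have "\<dots> = (\<integral>\<^sup>+h. t * indicator (B - F) h \<partial>lebesgue)" by (simp add: nn_integral_cmult_indicator)
    also have "\<dots> \<le> (\<integral>\<^sup>+h\<in>B - F. ennreal (\<nu> h) \<partial>lebesgue)"
      by (intro nn_integral_mono) (auto simp: B_def split: split_indicator)
    also have "(\<integral>\<^sup>+h\<in>B - F. ennreal (\<nu> h) \<partial>lebesgue) + (\<integral>\<^sup>+h\<in>A - F. ennreal (\<nu> h) \<partial>lebesgue)
       = (\<integral>\<^sup>+h. ennreal (\<nu> h) * indicator (B - F) h + ennreal (\<nu> h) * indicator (A - F) h \<partial>lebesgue)"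
      by (intro nn_integral_add[symmetric]) measurable
    also have "\<dots> \<le> (\<integral>\<^sup>+h\<in>-F. ennreal (\<nu> h) \<partial>lebesgue)"
      by (intro nn_integral_mono) (auto simp: A_def B_def split: split_indicator)
    finally show ?thesis by (simp add: add_right_mono)
  qed
qed

text \<open>Outside the unit ball the weight equals 1, so Chebyshev's inequality applies; the ball
  itself has finite measure.\<close>

lemma emeasure_superlevel_finite:
  fixes \<nu> :: "'a::euclidean_space \<Rightarrow> real"
  assumes [measurable]: "\<nu> \<in> borel_measurable lebesgue" and nn: "\<And>h. 0 \<le> \<nu> h"
    and int: "(\<integral>\<^sup>+h. ennreal (min 1 (norm h powr p) * \<nu> h) \<partial>lebesgue) < top" and "p \<ge> 0" "s > 0"
  shows "emeasure lebesgue {h. h \<noteq> 0 \<and> \<nu> h > s} < top"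
proof -
  note borel_measurable_ident_lebesgue [measurable]
  let ?E = "{h. norm h \<ge> 1 \<and> \<nu> h > s}"
  have [measurable]: "?E \<in> sets lebesgue" by (rule sets_lebesgue_Collect) measurable
  have "ennreal s * emeasure lebesgue ?E = (\<integral>\<^sup>+h. ennreal s * indicator ?E h \<partial>lebesgue)"
    by (simp add: nn_integral_cmult_indicator)
  also have "\<dots> \<le> (\<integral>\<^sup>+h. ennreal (min 1 (norm h powr p) * \<nu> h) \<partial>lebesgue)"
  proof (rule nn_integral_mono)
    fix h :: 'a
    have "min 1 (norm h powr p) = 1" if "1 \<le> norm h"
      using ge_one_powr_ge_zero[OF that \<open>p \<ge> 0\<close>] by simp
    then show "ennreal s * indicator ?E h \<le> ennreal (min 1 (norm h powr p) * \<nu> h)"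
      by (simp split: split_indicator add: ennreal_leI)
  qed
  finally have "ennreal s * emeasure lebesgue ?E < top"
    using int by (rule le_less_trans)
  then have "emeasure lebesgue ?E < top"
    using \<open>s > 0\<close> by (auto simp: ennreal_mult_less_top)
  moreover have "emeasure lebesgue (ball (0::'a) 1) < top"
    using emeasure_lborel_ball_finite[of "0::'a" 1] by simp
  ultimately have "emeasure lebesgue ?E + emeasure lebesgue (ball (0::'a) 1) < top"
    by (simp only: ennreal_add_less_top)
  moreover have "emeasure lebesgue {h. h \<noteq> 0 \<and> \<nu> h > s} \<le> emeasure lebesgue (?E \<union> ball 0 1)"
    by (intro emeasure_mono) auto
  moreover have "emeasure lebesgue (?E \<union> ball 0 1) \<le> emeasure lebesgue ?E + emeasure lebesgue (ball (0::'a) 1)"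
    by (intro emeasure_subadditive) auto
  ultimately show ?thesis
    by (simp only: le_less_trans)
qed

text \<open>The map \<open>y \<mapsto> x - y\<close> is affine with diagonal entries -1, so the
  change of variables for diagonal affine maps gives invariance directly for the completed
  measure.\<close>

lemma
  fixes f :: "'a::euclidean_space \<Rightarrow> ennreal"
  assumes f[measurable]: "f \<in> borel_measurable lebesgue"
  shows borel_measurable_lebesgue_reflect: "(\<lambda>y. f (x - y)) \<in> borel_measurable lebesgue"
    and nn_integral_lebesgue_reflect: "(\<integral>\<^sup>+y. f (x - y) \<partial>lebesgue) = (\<integral>\<^sup>+y. f y \<partial>lebesgue)"
proof -
  have T: "(\<lambda>y. x + (\<Sum>j\<in>Basis. (- 1 * (y \<bullet> j)) *\<^sub>R j)) = (\<lambda>y. x - y)"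
    by (simp add: sum_negf euclidean_representation)
  have eq: "lebesgue = distr lebesgue lebesgue (\<lambda>y. x - y)"
    using lebesgue_affine_euclidean[of "\<lambda>_. -1" x] unfolding T by (simp add: density_1)
  have [measurable]: "(\<lambda>y. x - y) \<in> lebesgue \<rightarrow>\<^sub>M lebesgue"
    using lebesgue_affine_measurable[of "\<lambda>_. -1" x] unfolding T by simp
  show "(\<lambda>y. f (x - y)) \<in> borel_measurable lebesgue" by measurable
  show "(\<integral>\<^sup>+y. f (x - y) \<partial>lebesgue) = (\<integral>\<^sup>+y. f y \<partial>lebesgue)"
    by (subst (2) eq) (simp add: nn_integral_distr)
qed

subsection \<open>Modular estimate for growth functions\<close>

lemma min_max_diff_le: "\<bar>max (- b) (min b x) - max (- b) (min b y)\<bar> \<le> \<bar>x - y :: real\<bar>"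
  by (simp add: max_def min_def abs_if)

text \<open>Soft thresholding is 1-Lipschitz. Composed with the clipping above it yields truncations
  that do not increase the nonlocal seminorm.\<close>

lemma diff_min_max_diff_le:
  "b \<ge> 0 \<Longrightarrow> \<bar>(x - max (- b) (min b x)) - (y - max (- b) (min b y))\<bar> \<le> \<bar>x - y :: real\<bar>"
  by (simp add: max_def min_def abs_if)

text \<open>\<open>\<phi>\<close> abstracts \<open>phi p \<nu>\<close>; the last assumption is \<open>w(1/\<phi>(t)) = 1/t\<close>.\<close>

locale nonlocal_growth =
  fixes p K :: real and \<nu> :: "'a::euclidean_space \<Rightarrow> real" and \<phi> :: "real \<Rightarrow> real"
  assumes p: "1 \<le> p" and K: "1 \<le> K"
    and \<nu>_measurable: "\<nu> \<in> borel_measurable lebesgue"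
    and \<nu>_nonneg: "0 \<le> \<nu> h"
    and \<nu>_superlevel: "s > 0 \<Longrightarrow> emeasure lebesgue {h. h \<noteq> 0 \<and> \<nu> h > s} < top"
    and \<phi>_0: "\<phi> 0 = 0"
    and \<phi>_mono: "0 \<le> s \<Longrightarrow> s \<le> t \<Longrightarrow> \<phi> s \<le> \<phi> t"
    and \<phi>_pos: "0 < t \<Longrightarrow> 0 < \<phi> t"
    and \<phi>_double: "0 \<le> t \<Longrightarrow> 2 * \<phi> t \<le> \<phi> (2 * t)"
    and \<phi>_double_le: "0 \<le> t \<Longrightarrow> \<phi> (2 * t) \<le> K * \<phi> t"
    and nu_sharp_ge: "0 < t \<Longrightarrow> ennreal (\<phi> t * t powr - p) \<le> nu_sharp \<nu> (1 / \<phi> t)"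
begin

definition modular :: "('a \<Rightarrow> real) \<Rightarrow> real \<Rightarrow> ennreal" where
  "modular v l = (\<integral>\<^sup>+x. ennreal (\<phi> (\<bar>v x\<bar> / l)) \<partial>lebesgue)"

lemma \<phi>_nonneg: "0 \<le> t \<Longrightarrow> 0 \<le> \<phi> t"
  using \<phi>_mono[of 0 t] \<phi>_0 by simp

lemma \<phi>_measurable [measurable]:
  assumes [measurable]: "v \<in> borel_measurable lebesgue" and "0 < l"
  shows "(\<lambda>x. \<phi> (\<bar>v x\<bar> / l)) \<in> borel_measurable lebesgue"
proof -
  \<comment> \<open>\<phi> is known to be monotone only on nonnegative arguments; precomposing with
    \<open>max 0\<close> gives a function monotone on the whole line, hence Borel.\<close>
  have "mono (\<lambda>t. \<phi> (max 0 t))" by (auto simp: mono_def intro!: \<phi>_mono)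
  then have [measurable]: "(\<lambda>t. \<phi> (max 0 t)) \<in> borel_measurable borel"
    by (rule borel_measurable_mono)
  have "(\<lambda>x. \<phi> (max 0 (\<bar>v x\<bar> / l))) \<in> borel_measurable lebesgue" by measurable
  then show ?thesis using \<open>0 < l\<close> by simp
qed

lemma growth_le_inner_integral:
  assumes v[measurable]: "v \<in> borel_measurable lebesgue" and l: "0 < l" and mod: "modular v l \<le> 1"
  shows "ennreal (l powr p * \<phi> (\<bar>v x\<bar> / (2 * l)))
           \<le> (\<integral>\<^sup>+y. ennreal (\<bar>v x - v y\<bar> powr p * \<nu> (x - y)) \<partial>lebesgue)"
proof (cases "v x = 0")
  case True
  then show ?thesis by (simp add: \<phi>_0)
next
  case False
  note \<nu>_measurable[measurable]
  \<comment> \<open>With this \<open>t\<close> the set \<open>E\<close> consists of the points where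
    \<open>\<bar>v y\<bar> / l\<close> exceeds \<open>t\<close>. \<open>F\<close> is
    \<open>E\<close> expressed in the variable \<open>h = x - y\<close> of the kernel.\<close>
  define t where "t = \<bar>v x\<bar> / (2 * l)"
  define E where "E = {y. \<bar>v y\<bar> > \<bar>v x\<bar> / 2}"
  define F where "F = {h. x - h \<in> E}"
  have t: "0 < t" using False l by (simp add: t_def)
  have lt: "l * t = \<bar>v x\<bar> / 2" using l by (simp add: t_def)
  have E[measurable]: "E \<in> sets lebesgue"
    unfolding E_def by (rule sets_lebesgue_Collect) measurable
  have ind: "indicator F h = (indicator E (x - h) :: ennreal)" for h
    by (auto simp: F_def split: split_indicator)
  have "(\<lambda>h. indicator F h :: ennreal) \<in> borel_measurable lebesgue"
    unfolding ind by (rule borel_measurable_lebesgue_reflect) measurable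
  then have F[measurable]: "F \<in> sets lebesgue"
    by (simp add: borel_measurable_indicator_iff)
  have FE: "emeasure lebesgue F = emeasure lebesgue E"
  proof -
    have "emeasure lebesgue F = (\<integral>\<^sup>+h. indicator F h \<partial>lebesgue)" by simp
    also have "\<dots> = (\<integral>\<^sup>+h. indicator E (x - h) \<partial>lebesgue)" by (simp only: ind)
    also have "\<dots> = (\<integral>\<^sup>+h. indicator E h \<partial>lebesgue)" by (rule nn_integral_lebesgue_reflect) measurable
    finally show ?thesis by simp
  qed
  \<comment> \<open>Chebyshev's inequality: the modular is at most 1, so \<open>E\<close> has
    measure at most \<open>1 / \<phi> t\<close>, the argument at which \<open>nu_sharp\<close> is
    bounded below.\<close>
  have "ennreal (\<phi> t) * emeasure lebesgue E = (\<integral>\<^sup>+y. ennreal (\<phi> t) * indicator E y \<partial>lebesgue)"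
    by (simp add: nn_integral_cmult_indicator)
  also have "\<dots> \<le> modular v l"
    unfolding modular_def
  proof (rule nn_integral_mono)
    fix y
    have "\<phi> t \<le> \<phi> (\<bar>v y\<bar> / l)" if "y \<in> E"
      using that l t by (intro \<phi>_mono) (auto simp: t_def E_def field_simps)
    then show "ennreal (\<phi> t) * indicator E y \<le> ennreal (\<phi> (\<bar>v y\<bar> / l))"
      by (auto intro: ennreal_leI split: split_indicator)
  qed
  also note mod
  finally have "ennreal (\<phi> t) * emeasure lebesgue E \<le> 1" .
  then have "ennreal (1 / \<phi> t) * (ennreal (\<phi> t) * emeasure lebesgue E) \<le> ennreal (1 / \<phi> t) * 1"
    by (rule mult_left_mono) simp
  moreover have "ennreal (1 / \<phi> t) * ennreal (\<phi> t) = 1"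
    using \<phi>_pos[OF t] by (simp add: ennreal_mult'[symmetric] less_imp_le)
  ultimately have Er: "emeasure lebesgue F \<le> ennreal (1 / \<phi> t)"
    by (simp add: FE mult.assoc[symmetric])
  \<comment> \<open>The powers of \<open>t\<close> are arranged so that the second factor is exactly
    the lower bound for \<open>nu_sharp\<close>, while \<open>l * t\<close> is half of
    \<open>\<bar>v x\<bar>\<close>.\<close>
  have "ennreal (l powr p * \<phi> t) = ennreal ((l * t) powr p) * ennreal (\<phi> t * t powr - p)"
    using l t \<phi>_pos[OF t]
    by (simp add: ennreal_mult'[symmetric] powr_mult powr_minus field_simps)
  also have "\<dots> \<le> ennreal ((l * t) powr p) * nu_sharp \<nu> (1 / \<phi> t)"
    by (intro mult_left_mono nu_sharp_ge t) simp
  also have "\<dots> \<le> ennreal ((l * t) powr p) * (\<integral>\<^sup>+h\<in>-F. ennreal (\<nu> h) \<partial>lebesgue)"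
    using \<phi>_pos[OF t] \<nu>_measurable \<nu>_nonneg \<nu>_superlevel F Er
    by (intro mult_left_mono nu_sharp_le_integral_Compl) auto
  also have "\<dots> = (\<integral>\<^sup>+h. ennreal ((l * t) powr p) * (ennreal (\<nu> h) * indicator (-F) h) \<partial>lebesgue)"
    by (rule nn_integral_cmult[symmetric]) measurable
  also have "\<dots> = (\<integral>\<^sup>+y. ennreal ((l * t) powr p) * (ennreal (\<nu> (x - y)) * indicator (-F) (x - y)) \<partial>lebesgue)"
    by (rule nn_integral_lebesgue_reflect[symmetric]) measurable
  also have "\<dots> \<le> (\<integral>\<^sup>+y. ennreal (\<bar>v x - v y\<bar> powr p * \<nu> (x - y)) \<partial>lebesgue)"
  proof (rule nn_integral_mono)
    fix y
    show "ennreal ((l * t) powr p) * (ennreal (\<nu> (x - y)) * indicator (-F) (x - y))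
            \<le> ennreal (\<bar>v x - v y\<bar> powr p * \<nu> (x - y))"
    proof (cases "y \<in> E")
      case True
      then show ?thesis by (simp add: F_def)
    next
      case False
      \<comment> \<open>Off \<open>E\<close> the value at \<open>y\<close> is at most half of that
        at \<open>x\<close> in modulus, so the triangle inequality leaves a difference of at least
        \<open>l * t\<close>.\<close>
      then have "(l * t) powr p \<le> \<bar>v x - v y\<bar> powr p"
        unfolding lt using p by (intro powr_mono2) (auto simp: E_def abs_if split: if_splits)
      then show ?thesis
        using \<nu>_nonneg[of "x - y"] False
        by (simp add: F_def ennreal_mult'[symmetric] mult_right_mono ennreal_leI)
    qed
  qed
  finally show ?thesis by (simp add: t_def)
qed

lemma modular_le_nonlocal_power:
  assumes [measurable]: "v \<in> borel_measurable lebesgue" and l: "0 < l" and "modular v l \<le> 1"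
  shows "ennreal (l powr p) * modular v (2 * l) \<le> nonlocal_power p \<nu> v"
proof -
  have "ennreal (l powr p) * modular v (2 * l)
      = (\<integral>\<^sup>+x. ennreal (l powr p) * ennreal (\<phi> (\<bar>v x\<bar> / (2 * l))) \<partial>lebesgue)"
    unfolding modular_def using \<phi>_measurable[OF assms(1), of "2 * l"] l
    by (intro nn_integral_cmult[symmetric]) simp
  also have "\<dots> \<le> nonlocal_power p \<nu> v"
    unfolding nonlocal_power_def
    using growth_le_inner_integral[OF assms] l
    by (intro nn_integral_mono) (simp add: ennreal_mult')
  finally show ?thesis .
qed

text \<open>Both bounds integrate the doubling properties of \<phi>. The first makes the modular
  decay as the scale doubles, the second keeps it from dropping abruptly.\<close>

lemma modular_double:
  assumes [measurable]: "v \<in> borel_measurable lebesgue" and l: "0 < l"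
  shows "2 * modular v (2 * l) \<le> modular v l" "modular v l \<le> ennreal K * modular v (2 * l)"
proof -
  have m: "(\<lambda>x. ennreal (\<phi> (\<bar>v x\<bar> / (2 * l)))) \<in> borel_measurable lebesgue"
    using \<phi>_measurable[OF assms(1), of "2 * l"] l by simp
  have eq: "\<phi> (\<bar>v x\<bar> / l) = \<phi> (2 * (\<bar>v x\<bar> / (2 * l)))" for x
    using l by simp
  have "2 * modular v (2 * l) = (\<integral>\<^sup>+x. 2 * ennreal (\<phi> (\<bar>v x\<bar> / (2 * l))) \<partial>lebesgue)"
    unfolding modular_def using m by (rule nn_integral_cmult[symmetric])
  also have "\<dots> = (\<integral>\<^sup>+x. ennreal (2 * \<phi> (\<bar>v x\<bar> / (2 * l))) \<partial>lebesgue)"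
    by (simp add: ennreal_mult')
  also have "\<dots> \<le> modular v l"
    unfolding modular_def eq using l by (intro nn_integral_mono ennreal_leI \<phi>_double) simp
  finally show "2 * modular v (2 * l) \<le> modular v l" .
  have "modular v l \<le> (\<integral>\<^sup>+x. ennreal (K * \<phi> (\<bar>v x\<bar> / (2 * l))) \<partial>lebesgue)"
    unfolding modular_def eq using l by (intro nn_integral_mono ennreal_leI \<phi>_double_le) simp
  also have "\<dots> = (\<integral>\<^sup>+x. ennreal K * ennreal (\<phi> (\<bar>v x\<bar> / (2 * l))) \<partial>lebesgue)"
    using K by (simp add: ennreal_mult')
  also have "\<dots> = ennreal K * modular v (2 * l)"
    unfolding modular_def using m by (rule nn_integral_cmult)
  finally show "modular v l \<le> ennreal K * modular v (2 * l)" .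
qed

text \<open>If the modular at \<open>l\<close> exceeded 1, doubling the scale would reach a first
  scale where it is at most 1. There the seminorm estimate applies, while the modular one doubling
  later is still at least \<open>1 / K\<^sup>2\<close>. This makes the seminorm too large.\<close>

lemma modular_le_1:
  assumes v: "v \<in> borel_measurable lebesgue" and l: "0 < l"
    and fin: "modular v l < top" and I: "ennreal (K\<^sup>2) * nonlocal_power p \<nu> v < ennreal (l powr p)"
  shows "modular v l \<le> 1"
proof (rule ccontr)
  assume neg: "\<not> modular v l \<le> 1"
  \<comment> \<open>Geometric decay in \<open>n\<close>; starting from a finite value, some doubled
    scale must have modular at most 1.\<close>
  have pow: "ennreal (2 ^ n) * modular v (2 ^ n * l) \<le> modular v l" for n
  proof (induction n)
    case (Suc n)
    have "ennreal (2 ^ Suc n) * modular v (2 ^ Suc n * l) = ennreal (2 ^ n) * (2 * modular v (2 * (2 ^ n * l)))"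
      by (simp add: ennreal_mult' mult_ac)
    also have "\<dots> \<le> ennreal (2 ^ n) * modular v (2 ^ n * l)"
      using l v by (intro mult_left_mono modular_double) auto
    finally show ?case using Suc by simp
  qed simp
  obtain m where m: "modular v l = ennreal m" "0 \<le> m"
    using fin by (cases "modular v l") auto
  obtain n0 where n0: "m < 2 ^ n0" using real_arch_pow[of 2 m] by auto
  have "modular v (2 ^ n0 * l) \<le> 1"
  proof (rule ccontr)
    assume "\<not> modular v (2 ^ n0 * l) \<le> 1"
    then have "ennreal (2 ^ n0) * 1 \<le> ennreal (2 ^ n0) * modular v (2 ^ n0 * l)"
      by (intro mult_left_mono) auto
    then have "ennreal (2 ^ n0) \<le> ennreal m"
      using pow[of n0] unfolding m(1) mult_1_right by (rule order.trans)
    with m n0 show False by (simp add: ennreal_le_iff)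
  qed
  \<comment> \<open>The least such \<open>n\<close> is not 0, so the preceding scale \<mu> still has
    modular above 1.\<close>
  then obtain n where n: "modular v (2 ^ n * l) \<le> 1" "\<And>k. k < n \<Longrightarrow> \<not> modular v (2 ^ k * l) \<le> 1"
    using exists_least_iff[of "\<lambda>n. modular v (2 ^ n * l) \<le> 1"] by blast
  with neg obtain k where k: "n = Suc k" by (cases n) auto
  define \<mu> where "\<mu> = 2 ^ k * l"
  have \<mu>: "0 < \<mu>" "l \<le> \<mu>" using l by (auto simp: \<mu>_def)
  have "1 < modular v \<mu>" using n(2)[of k] k by (simp add: \<mu>_def)
  also have "\<dots> \<le> ennreal K * modular v (2 * \<mu>)" using v \<mu> by (intro modular_double)
  \<comment> \<open>Two doublings are used because the seminorm estimate needs modular at most 1,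
    available at \<open>2 * \<mu>\<close>, and then controls the modular at
    \<open>4 * \<mu>\<close>.\<close>
  also have "\<dots> \<le> ennreal K * (ennreal K * modular v (2 * (2 * \<mu>)))"
    using v \<mu> by (intro modular_double mult_left_mono) auto
  also have "\<dots> = ennreal (K\<^sup>2) * modular v (2 * (2 * \<mu>))"
    using K by (simp add: power2_eq_square ennreal_mult' mult.assoc)
  finally have big: "1 \<le> ennreal (K\<^sup>2) * modular v (2 * (2 * \<mu>))" by simp
  have "ennreal (l powr p) \<le> ennreal ((2 * \<mu>) powr p) * 1"
    using \<mu> l p by (auto intro!: ennreal_leI powr_mono2)
  also have "\<dots> \<le> ennreal ((2 * \<mu>) powr p) * (ennreal (K\<^sup>2) * modular v (2 * (2 * \<mu>)))"
    using big by (rule mult_left_mono) simp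
  also have "\<dots> = ennreal (K\<^sup>2) * (ennreal ((2 * \<mu>) powr p) * modular v (2 * (2 * \<mu>)))"
    by (simp add: mult_ac)
  also have "\<dots> \<le> ennreal (K\<^sup>2) * nonlocal_power p \<nu> v"
    using v \<mu> n(1) k by (intro mult_left_mono modular_le_nonlocal_power) (auto simp: \<mu>_def mult_ac)
  finally show False using I by simp
qed

text \<open>Truncation removes the assumption of a finite modular. The truncated functions are
  bounded and live on sets of finite measure, so their modulars are finite, and being 1-Lipschitz
  images of \<open>u\<close> they obey the same seminorm bound.\<close>

lemma modular_le_1_Lp:
  assumes u: "u \<in> Lp_space p" and l: "0 < l"
    and I: "ennreal (K\<^sup>2) * nonlocal_power p \<nu> u < ennreal (l powr p)"
  shows "modular u (2 * l) \<le> 1"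
proof -
  have [measurable]: "u \<in> borel_measurable lebesgue" and Lp: "Lp_power p u < top"
    using u by (auto simp: Lp_space_def)
  define \<epsilon> where "\<epsilon> n = 1 / real (Suc n)" for n
  \<comment> \<open>Thresholding at height \<open>\<epsilon> n\<close> confines the support to a set
    of finite measure, since \<open>u\<close> is in \<open>L\<^sup>p\<close>; clipping at
    \<open>n\<close> makes the function bounded.\<close>
  define s where "s n x = u x - max (- \<epsilon> n) (min (\<epsilon> n) (u x))" for n x
  define v where "v n x = max (- real n) (min (real n) (s n x))" for n x
  have \<epsilon>: "0 < \<epsilon> n" for n by (simp add: \<epsilon>_def)
  have v_diff: "\<bar>v n x - v n y\<bar> \<le> \<bar>u x - u y\<bar>" for n x y
    unfolding v_def s_def
    by (rule order.trans[OF min_max_diff_le diff_min_max_diff_le]) (simp add: \<epsilon> less_imp_le)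
  have v_bound: "\<bar>v n x\<bar> \<le> n" for n x
    by (auto simp: v_def)
  have [measurable]: "v n \<in> borel_measurable lebesgue" for n
    unfolding v_def s_def by measurable
  have power_mono: "nonlocal_power p \<nu> (v n) \<le> nonlocal_power p \<nu> u" for n
    unfolding nonlocal_power_def using p v_diff \<nu>_nonneg
    by (intro nn_integral_mono ennreal_leI mult_right_mono powr_mono2) auto
  have support: "emeasure lebesgue {x. \<bar>u x\<bar> > \<epsilon> n} < top" for n
  proof -
    let ?S = "{x. \<bar>u x\<bar> > \<epsilon> n}"
    have [measurable]: "?S \<in> sets lebesgue" by (rule sets_lebesgue_Collect) measurable
    have "ennreal (\<epsilon> n powr p) * emeasure lebesgue ?S = (\<integral>\<^sup>+x. ennreal (\<epsilon> n powr p) * indicator ?S x \<partial>lebesgue)"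
      by (simp add: nn_integral_cmult_indicator)
    also have "\<dots> \<le> Lp_power p u"
      unfolding Lp_power_def using p \<epsilon>[of n]
      by (intro nn_integral_mono) (auto intro!: ennreal_leI powr_mono2 split: split_indicator)
    finally have "ennreal (\<epsilon> n powr p) * emeasure lebesgue ?S < top"
      using Lp by (rule le_less_trans)
    then show ?thesis using \<epsilon>[of n] by (auto simp: ennreal_mult_less_top)
  qed
  have "modular (v n) l < top" for n
  proof -
    let ?S = "{x. \<bar>u x\<bar> > \<epsilon> n}"
    have [measurable]: "?S \<in> sets lebesgue" by (rule sets_lebesgue_Collect) measurable
    have "modular (v n) l \<le> (\<integral>\<^sup>+x. ennreal (\<phi> (n / l)) * indicator ?S x \<partial>lebesgue)"
      unfolding modular_def
    proof (rule nn_integral_mono)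
      fix x
      have "v n x = 0" if "x \<notin> ?S" using that by (auto simp: v_def s_def)
      then show "ennreal (\<phi> (\<bar>v n x\<bar> / l)) \<le> ennreal (\<phi> (n / l)) * indicator ?S x"
        using v_bound[of n x] l
        by (cases "x \<in> ?S") (auto simp: \<phi>_0 intro!: ennreal_leI \<phi>_mono divide_right_mono)
    qed
    also have "\<dots> = ennreal (\<phi> (n / l)) * emeasure lebesgue ?S"
      by (simp add: nn_integral_cmult_indicator)
    also have "\<dots> < top" using support[of n] by (simp add: ennreal_mult_less_top)
    finally show ?thesis .
  qed
  moreover have "ennreal (K\<^sup>2) * nonlocal_power p \<nu> (v n) < ennreal (l powr p)" for n
    using mult_left_mono[OF power_mono[of n], of "ennreal (K\<^sup>2)"] I by simp
  ultimately have le1: "modular (v n) l \<le> 1" for n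
    using l by (intro modular_le_1) auto
  have lim: "(\<lambda>n. v n x) \<longlonglongrightarrow> u x" for x
  proof (rule LIMSEQ_I)
    fix r :: real assume r: "0 < r"
    obtain N where N: "1 / real (Suc N) < r" using r nat_approx_posE by blast
    obtain M where M: "\<bar>u x\<bar> \<le> real M" using real_arch_simple by blast
    show "\<exists>n0. \<forall>n\<ge>n0. norm (v n x - u x) < r"
    proof (intro exI allI impI)
      fix n assume n: "n \<ge> max N M"
      have "\<epsilon> n \<le> 1 / real (Suc N)" using n by (auto simp: \<epsilon>_def intro!: divide_left_mono)
      moreover have "\<bar>u x\<bar> \<le> n" using n M by linarith
      then have "\<bar>v n x - u x\<bar> \<le> \<epsilon> n" using \<epsilon>[of n] by (auto simp: v_def s_def max_def min_def)
      ultimately show "norm (v n x - u x) < r" using N by simp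
    qed
  qed
  \<comment> \<open>Fatou's lemma. The extra factor 2 replaces continuity of \<phi>: eventually
    \<open>\<bar>v n x\<bar>\<close> exceeds half of \<open>\<bar>u x\<bar>\<close>, and
    monotonicity suffices.\<close>
  have "modular u (2 * l) \<le> (\<integral>\<^sup>+x. liminf (\<lambda>n. ennreal (\<phi> (\<bar>v n x\<bar> / l))) \<partial>lebesgue)"
    unfolding modular_def
  proof (rule nn_integral_mono)
    fix x
    show "ennreal (\<phi> (\<bar>u x\<bar> / (2 * l))) \<le> liminf (\<lambda>n. ennreal (\<phi> (\<bar>v n x\<bar> / l)))"
    proof (cases "u x = 0")
      case False
      have "(\<lambda>n. \<bar>v n x\<bar>) \<longlonglongrightarrow> \<bar>u x\<bar>" using lim by (rule tendsto_rabs)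
      then have "\<forall>\<^sub>F n in sequentially. \<bar>u x\<bar> / 2 < \<bar>v n x\<bar>"
        by (rule order_tendstoD) (use False in auto)
      then have "\<forall>\<^sub>F n in sequentially. ennreal (\<phi> (\<bar>u x\<bar> / (2 * l))) \<le> ennreal (\<phi> (\<bar>v n x\<bar> / l))"
        by eventually_elim (use l in \<open>auto intro!: ennreal_leI \<phi>_mono simp: field_simps\<close>)
      then show ?thesis by (rule Liminf_bounded)
    qed (simp add: \<phi>_0)
  qed
  also have "\<dots> \<le> liminf (\<lambda>n. modular (v n) l)"
    unfolding modular_def using l by (intro nn_integral_liminf) measurable
  also have "\<dots> \<le> 1" using le1 by (intro Liminf_le) (auto simp: le1)
  finally show ?thesis .
qed

end

subsection \<open>The growth function of the potential\<close>

context
  fixes p \<theta> :: real and \<nu> :: "'a::euclidean_space \<Rightarrow> real"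
  assumes p: "1 \<le> p"
    and bij: "bij_betw (potential p \<nu>) {0..} {0..}"
begin

lemma inverse_potential:
  assumes "0 < t"
  shows "0 < the_inv_into {0..} (potential p \<nu>) (1 / t)"
    and "potential p \<nu> (the_inv_into {0..} (potential p \<nu>) (1 / t)) = 1 / t"
proof -
  let ?r = "the_inv_into {0..} (potential p \<nu>) (1 / t)"
  have inj: "inj_on (potential p \<nu>) {0..}" and img: "1 / t \<in> potential p \<nu> ` {0..}"
    using bij assms by (auto simp: bij_betw_def)
  show w: "potential p \<nu> ?r = 1 / t"
    using inj img by (rule f_the_inv_into_f)
  have "0 \<le> ?r" using the_inv_into_into[OF inj img order_refl] by simp
  \<comment> \<open>The potential is 0 at 0 by definition, whereas its value here is
    \<open>1 / t\<close>.\<close>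
  moreover have "?r \<noteq> 0" using w assms by (auto simp: potential_def)
  ultimately show "0 < ?r" by simp
qed

lemma phi_pos: "0 < t \<Longrightarrow> 0 < phi p \<nu> t"
  using inverse_potential(1) by (simp add: phi_def)

lemma phi_nonneg: "0 \<le> phi p \<nu> t"
  using phi_pos[of t] by (cases "0 < t") (auto simp: phi_def)

text \<open>Put \<open>r = 1 / phi p \<nu> t\<close>, the point where the potential equals
  \<open>1 / t\<close>; raising this equation to the power \<open>p\<close> gives
  \<open>r * nu_sharp \<nu> r = t powr - p\<close>.\<close>

lemma nu_sharp_inverse_phi:
  assumes "0 < t"
  shows "ennreal (phi p \<nu> t * t powr - p) \<le> nu_sharp \<nu> (1 / phi p \<nu> t)"
proof -
  define r where "r = the_inv_into {0..} (potential p \<nu>) (1 / t)"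
  have r: "0 < r" and w: "potential p \<nu> r = 1 / t"
    using inverse_potential[OF assms] by (simp_all add: r_def)
  have "r * enn2real (nu_sharp \<nu> r) = ((r * enn2real (nu_sharp \<nu> r)) powr (1 / p)) powr p"
    using p r by (simp add: powr_powr)
  also have "\<dots> = (1 / t) powr p" using w r by (simp add: potential_def)
  also have "\<dots> = t powr - p" using assms by (simp add: powr_minus powr_divide inverse_eq_divide)
  finally have "enn2real (nu_sharp \<nu> r) = (1 / r) * t powr - p" using r by (simp add: field_simps)
  moreover have "phi p \<nu> t = 1 / r" using assms by (simp add: phi_def r_def)
  \<comment> \<open>Only an inequality, because \<open>enn2real\<close> sends infinity to 0; this is
    the direction used.\<close>
  moreover have "ennreal (enn2real (nu_sharp \<nu> r)) \<le> nu_sharp \<nu> r"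
    by (cases "nu_sharp \<nu> r") auto
  ultimately show ?thesis by simp
qed

context
  assumes young: "young_function (extend_top (\<lambda>t. phi p \<nu> (t powr (1 / p))))"
begin

text \<open>This is convexity of \<open>\<lambda>t. phi p \<nu> (t powr (1 / p))\<close> between \<open>0\<close> and \<open>t powr p\<close>.\<close>

lemma phi_mult_le:
  assumes "0 \<le> a" "a \<le> 1" "0 \<le> t"
  shows "phi p \<nu> (a * t) \<le> a powr p * phi p \<nu> t"
proof -
  let ?\<Phi> = "extend_top (\<lambda>t. phi p \<nu> (t powr (1 / p)))"
  have a: "0 \<le> a powr p" "a powr p \<le> 1" using assms p by (auto intro: powr_le1)
  have \<Phi>: "?\<Phi> (ennreal (s powr p)) = ennreal (phi p \<nu> s)" if "0 \<le> s" for s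
    using that p by (simp add: extend_top_def powr_powr)
  have "?\<Phi> (ennreal (a powr p) * ennreal (t powr p) + ennreal (1 - a powr p) * 0)
      \<le> ennreal (a powr p) * ?\<Phi> (ennreal (t powr p)) + ennreal (1 - a powr p) * ?\<Phi> 0"
    using young a unfolding young_function_def by blast
  moreover have "?\<Phi> 0 = 0" using young unfolding young_function_def by blast
  moreover have "ennreal (a powr p) * ennreal (t powr p) = ennreal ((a * t) powr p)"
    using assms by (simp add: ennreal_mult'[symmetric] powr_mult)
  ultimately have "ennreal (phi p \<nu> (a * t)) \<le> ennreal (a powr p) * ennreal (phi p \<nu> t)"
    using \<Phi>[of t] \<Phi>[of "a * t"] assms by simp
  then show ?thesis
    using phi_nonneg[of t] a by (simp add: ennreal_mult'[symmetric])
qed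

lemma phi_mono:
  assumes "0 \<le> s" "s \<le> t"
  shows "phi p \<nu> s \<le> phi p \<nu> t"
proof (cases "t = 0")
  case False
  then have t: "0 < t" using assms by simp
  have "phi p \<nu> (s / t * t) \<le> (s / t) powr p * phi p \<nu> t"
    using assms t by (intro phi_mult_le) auto
  also have "\<dots> \<le> 1 * phi p \<nu> t"
    using assms t p phi_nonneg[of t] by (intro mult_right_mono powr_le1) auto
  finally show ?thesis using t by simp
qed (use assms in simp)

text \<open>The scaling inequality at 1/2 gives the factor \<open>(1 / 2) powr p\<close>, which is
  at most 1/2 since \<open>p\<close> is at least 1.\<close>

lemma phi_double:
  assumes "0 \<le> t"
  shows "2 * phi p \<nu> t \<le> phi p \<nu> (2 * t)"
proof -
  have "phi p \<nu> t \<le> (1 / 2) powr p * phi p \<nu> (2 * t)"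
    using phi_mult_le[of "1 / 2" "2 * t"] assms by simp
  also have "\<dots> \<le> (1 / 2) powr 1 * phi p \<nu> (2 * t)"
    using p phi_nonneg by (intro mult_right_mono powr_mono') auto
  finally show ?thesis by simp
qed

text \<open>The submultiplicativity hypothesis for the pair \<open>t\<close>, \<open>2 * t\<close>
  has the constant left side \<open>phi p \<nu> (\<theta> / 2)\<close>, whose reciprocal is the
  doubling constant. The maximum with 1 gives the normalisation \<open>1 \<le> K\<close> of the
  locale.\<close>

lemma phi_double_le:
  assumes "0 < \<theta>"
    and sub: "\<And>s t. 0 \<le> s \<Longrightarrow> s \<le> t \<Longrightarrow> 0 < t \<Longrightarrow> phi p \<nu> (\<theta> * s / t) \<le> phi p \<nu> s / phi p \<nu> t"
    and "0 \<le> t"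
  shows "phi p \<nu> (2 * t) \<le> max 1 (1 / phi p \<nu> (\<theta> / 2)) * phi p \<nu> t"
proof (cases "t = 0")
  case False
  then have t: "0 < t" using assms by simp
  have "phi p \<nu> (\<theta> / 2) \<le> phi p \<nu> t / phi p \<nu> (2 * t)"
    using sub[of t "2 * t"] t by simp
  then have "phi p \<nu> (2 * t) \<le> 1 / phi p \<nu> (\<theta> / 2) * phi p \<nu> t"
    using phi_pos[of "\<theta> / 2"] phi_pos[of "2 * t"] t \<open>0 < \<theta>\<close> by (simp add: field_simps)
  also have "\<dots> \<le> max 1 (1 / phi p \<nu> (\<theta> / 2)) * phi p \<nu> t"
    using phi_nonneg by (intro mult_right_mono) auto
  finally show ?thesis .
qed (simp add: phi_def)

end
end

section \<open>From the modular estimate to the Orlicz norm\<close>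

lemma (in nonlocal_growth) orlicz_integral_le_1:
  assumes u: "u \<in> nonlocal_space p \<nu>" and c: "0 < c" and \<psi>0: "\<psi> 0 = 0"
    and \<psi>: "\<And>t::real. 0 < t \<Longrightarrow> \<psi> (ennreal (c * t)) \<le> ennreal (max (t powr p) (\<phi> t))"
    and l: "4 * K powr (2 / p) / c * nonlocal_norm p \<nu> u < l"
  shows "(\<integral>\<^sup>+x. \<psi> (ennreal (\<bar>u x\<bar> / l)) \<partial>lebesgue) \<le> 1"
proof -
  let ?P = "Lp_power p u" and ?I = "nonlocal_power p \<nu> u"
  have [measurable]: "u \<in> borel_measurable lebesgue" and Lp: "u \<in> Lp_space p" and fin: "?P < top" "?I < top"
    using u by (auto simp: nonlocal_space_def Lp_space_def)
  \<comment> \<open>Then \<open>\<bar>u x\<bar> / l\<close> equals \<open>c\<close> times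
    \<open>\<bar>u x\<bar> / (4 * m)\<close>. One factor 2 of the 4 is the loss in the truncation
    argument; the other halves the modular and leaves room for the \<open>L\<^sup>p\<close>
    term.\<close>
  define m where "m = c * l / 4"
  have "K powr (2 / p) * nonlocal_norm p \<nu> u < m"
    using l c by (simp add: m_def field_simps)
  moreover have "0 \<le> K powr (2 / p) * nonlocal_norm p \<nu> u"
    by (simp add: nonlocal_norm_def)
  ultimately have m: "0 < m" and "(K powr (2 / p) * nonlocal_norm p \<nu> u) powr p < m powr p"
    using p by (auto intro: powr_less_mono2)
  moreover have "(K powr (2 / p) * nonlocal_norm p \<nu> u) powr p = K\<^sup>2 * enn2real (?P + ?I)"
    using K p by (simp add: nonlocal_norm_def powr_mult powr_powr)
  ultimately have "ennreal (K\<^sup>2 * enn2real (?P + ?I)) < ennreal (m powr p)"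
    by (intro ennreal_lessI) auto
  moreover have "ennreal (enn2real (?P + ?I)) = ?P + ?I"
    using fin by simp
  ultimately have bound: "ennreal (K\<^sup>2) * (?P + ?I) < ennreal (m powr p)"
    by (simp add: ennreal_mult)
  have "ennreal (K\<^sup>2) * ?I \<le> ennreal (K\<^sup>2) * (?P + ?I)" "ennreal (K\<^sup>2) * ?P \<le> ennreal (K\<^sup>2) * (?P + ?I)"
    by (intro mult_left_mono; simp)+
  with bound have I: "ennreal (K\<^sup>2) * ?I < ennreal (m powr p)" and "ennreal (K\<^sup>2) * ?P < ennreal (m powr p)"
    by (blast intro: le_less_trans)+
  moreover have "1 * ?P \<le> ennreal (K\<^sup>2) * ?P"
    using K by (intro mult_right_mono) (simp_all add: one_le_power)
  ultimately have P: "?P < ennreal (m powr p)" by (simp only: mult_1 le_less_trans)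
  have "2 * modular u (2 * (2 * m)) \<le> modular u (2 * m)"
    using m by (intro modular_double) auto
  also have "\<dots> \<le> 1" using Lp m I by (rule modular_le_1_Lp)
  finally have mod: "2 * modular u (4 * m) \<le> 1" by simp
  have lc: "l = 4 * m / c" using c by (simp add: m_def)
  have "(\<integral>\<^sup>+x. \<psi> (ennreal (\<bar>u x\<bar> / l)) \<partial>lebesgue)
      \<le> (\<integral>\<^sup>+x. ennreal ((4 * m) powr - p) * ennreal (norm (u x) powr p) + ennreal (\<phi> (\<bar>u x\<bar> / (4 * m))) \<partial>lebesgue)"
  proof (rule nn_integral_mono)
    fix x
    define t where "t = \<bar>u x\<bar> / (4 * m)"
    have t: "0 \<le> t" "\<bar>u x\<bar> / l = c * t" using c m by (auto simp: t_def lc)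
    have "\<psi> (ennreal (c * t)) \<le> ennreal (t powr p) + ennreal (\<phi> t)"
    proof (cases "t = 0")
      case False
      then have "\<psi> (ennreal (c * t)) \<le> ennreal (max (t powr p) (\<phi> t))" using \<psi> t by simp
      also have "\<dots> \<le> ennreal (t powr p + \<phi> t)"
        using \<phi>_nonneg[OF t(1)] by (intro ennreal_leI) auto
      finally show ?thesis using \<phi>_nonneg[OF t(1)] by simp
    qed (simp add: \<psi>0)
    moreover have "t powr p = (4 * m) powr - p * norm (u x) powr p"
      using m by (simp add: t_def powr_divide powr_minus field_simps)
    ultimately show "\<psi> (ennreal (\<bar>u x\<bar> / l)) \<le> ennreal ((4 * m) powr - p) * ennreal (norm (u x) powr p) + ennreal (\<phi> (\<bar>u x\<bar> / (4 * m)))"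
      unfolding t(2) by (simp add: ennreal_mult t_def)
  qed
  also have "\<dots> = ennreal ((4 * m) powr - p) * ?P + modular u (4 * m)"
    unfolding Lp_power_def modular_def using m \<phi>_measurable[of u "4 * m"]
    by (subst nn_integral_add) (simp_all add: nn_integral_cmult)
  also have "\<dots> \<le> ennreal (1 / 2) + ennreal (1 / 2)"
  proof (rule add_mono)
    \<comment> \<open>The powers of \<open>m\<close> cancel and leave \<open>4 powr - p\<close>,
      which is at most 1/4.\<close>
    have "ennreal ((4 * m) powr - p) * ?P \<le> ennreal ((4 * m) powr - p) * ennreal (m powr p)"
      using P by (intro mult_left_mono) auto
    also have "\<dots> = ennreal (4 powr - p)"
      using m by (simp add: ennreal_mult[symmetric] powr_mult powr_minus field_simps)
    also have "4 powr - p \<le> 4 powr - (1::real)" using p by (intro powr_mono) auto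
    then have "ennreal (4 powr - p) \<le> ennreal (1 / 2)" by (intro ennreal_leI) (simp add: powr_minus)
    finally show "ennreal ((4 * m) powr - p) * ?P \<le> ennreal (1 / 2)" .
    have "ennreal (1 / 2) * (2 * modular u (4 * m)) \<le> ennreal (1 / 2) * 1"
      using mod by (rule mult_left_mono) simp
    moreover have "ennreal (1 / 2) * ennreal 2 = 1"
      by (subst ennreal_mult[symmetric]) simp_all
    ultimately show "modular u (4 * m) \<le> ennreal (1 / 2)"
      by (simp add: mult.assoc[symmetric])
  qed
  also have "\<dots> = ennreal (1 / 2 + 1 / 2)" by (rule ennreal_plus[symmetric]) simp_all
  also have "\<dots> = 1" by simp
  finally show ?thesis .
qed

text \<open>Testing only \<open>l\<close> strictly above \<open>b\<close> keeps \<open>l\<close>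
  positive even when \<open>b\<close> is 0.\<close>

lemma luxemburg_norm_le:
  assumes "\<And>l. b < l \<Longrightarrow> (\<integral>\<^sup>+x. \<psi> (ennreal (\<bar>u x\<bar> / l)) \<partial>lebesgue) \<le> 1" and "0 \<le> b"
  shows "luxemburg_norm \<psi> u \<le> b"
proof (rule field_le_epsilon)
  fix e :: real assume "0 < e"
  then show "luxemburg_norm \<psi> u \<le> b + e"
    unfolding luxemburg_norm_def using assms by (intro cInf_lower) (auto intro: bdd_belowI[of _ 0] less_imp_le)
qed

lemma (in nonlocal_growth) nonlocal_space_embeds_orlicz_space:
  assumes "0 < c" "\<psi> 0 = 0"
    and "\<And>t::real. 0 < t \<Longrightarrow> \<psi> (ennreal (c * t)) \<le> ennreal (max (t powr p) (\<phi> t))"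
  shows "continuous_embedding (nonlocal_space p \<nu>) (nonlocal_norm p \<nu>) (orlicz_space \<psi>) (luxemburg_norm \<psi>)"
  unfolding continuous_embedding_def
proof (intro conjI subsetI exI ballI)
  fix u assume u: "u \<in> nonlocal_space p \<nu>"
  let ?b = "4 * K powr (2 / p) / c * nonlocal_norm p \<nu> u"
  have b: "0 \<le> ?b" using \<open>0 < c\<close> by (simp add: nonlocal_norm_def)
  note le = orlicz_integral_le_1[OF u assms]
  show "luxemburg_norm \<psi> u \<le> ?b" by (intro luxemburg_norm_le le b)
  \<comment> \<open>Adding 1 gives an admissible scale that is positive also when the norm of
    \<open>u\<close> vanishes.\<close>
  have "(\<integral>\<^sup>+x. \<psi> (ennreal (\<bar>u x\<bar> / (?b + 1))) \<partial>lebesgue) < top"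
    using le[of "?b + 1"] by (auto intro: le_less_trans)
  moreover have "0 < ?b + 1" using b by linarith
  ultimately show "u \<in> orlicz_space \<psi>"
    using u unfolding orlicz_space_def nonlocal_space_def Lp_space_def by blast
qed

subsection \<open>Smooth bumps on boxes\<close>

lemma C_k_SucI:
  assumes "\<And>x. (f has_derivative D x) (at x)" and "\<And>i. i \<in> Basis \<Longrightarrow> C_k k (\<lambda>x. D x i)"
  shows "C_k (Suc k) f"
proof -
  have "frechet_derivative f (at x) = D x" for x
    using frechet_derivative_at[OF assms(1)] by simp
  then show ?thesis using assms by (auto simp: differentiable_def)
qed

text \<open>The product rule leaves undifferentiated factors beside derivatives, so the induction
  for products must lower the order of smoothness by one.\<close>

lemma C_k_SucD: "C_k (Suc k) f \<Longrightarrow> C_k k f"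
proof (induction k arbitrary: f)
  case 0
  then show ?case
    by (auto simp: continuous_on_eq_continuous_within intro!: differentiable_imp_continuous_within)
next
  case (Suc k)
  then have "\<forall>x. f differentiable (at x)"
    and "\<forall>i\<in>Basis. C_k (Suc k) (\<lambda>x. frechet_derivative f (at x) i)"
    using C_k.simps(2)[of "Suc k" f] by blast+
  with Suc.IH show ?case unfolding C_k.simps(2)[of k] by blast
qed

lemma C_k_Suc_has_derivative:
  "C_k (Suc k) f \<Longrightarrow> (f has_derivative frechet_derivative f (at x)) (at x)"
  by (simp add: frechet_derivative_works)

lemma C_k_const: "C_k k (\<lambda>x. c)"
proof (induction k arbitrary: c)
  case (Suc k)
  show ?case by (rule C_k_SucI[where D="\<lambda>x h. 0"]) (use Suc in \<open>auto intro!: derivative_eq_intros\<close>)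
qed simp

lemma C_k_add: "C_k k f \<Longrightarrow> C_k k g \<Longrightarrow> C_k k (\<lambda>x. f x + g x)"
proof (induction k arbitrary: f g)
  case (Suc k)
  show ?case
  proof (rule C_k_SucI)
    show "((\<lambda>x. f x + g x) has_derivative (\<lambda>h. frechet_derivative f (at x) h + frechet_derivative g (at x) h)) (at x)" for x
      using Suc.prems by (intro has_derivative_add C_k_Suc_has_derivative)
    show "C_k k (\<lambda>x. frechet_derivative f (at x) i + frechet_derivative g (at x) i)" if "i \<in> Basis" for i
      using Suc.prems that by (intro Suc.IH) simp_all
  qed
qed (simp add: continuous_on_add)

lemma C_k_mult: "C_k k f \<Longrightarrow> C_k k g \<Longrightarrow> C_k k (\<lambda>x. f x * g x)"
proof (induction k arbitrary: f g)
  case (Suc k)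
  show ?case
  proof (rule C_k_SucI)
    show "((\<lambda>x. f x * g x) has_derivative
        (\<lambda>h. f x * frechet_derivative g (at x) h + frechet_derivative f (at x) h * g x)) (at x)" for x
      using Suc.prems by (intro has_derivative_mult C_k_Suc_has_derivative)
    have "C_k k f" "C_k k g" using Suc.prems by (blast intro: C_k_SucD)+
    then show "C_k k (\<lambda>x. f x * frechet_derivative g (at x) i + frechet_derivative f (at x) i * g x)" if "i \<in> Basis" for i
      using Suc.prems that by (intro C_k_add Suc.IH) simp_all
  qed
qed (simp add: continuous_on_mult)

lemma C_k_prod: "(\<And>i. i \<in> I \<Longrightarrow> C_k k (f i)) \<Longrightarrow> C_k k (\<lambda>x. \<Prod>i\<in>I. f i x)"
  by (induction I rule: infinite_finite_induct) (simp_all add: C_k_mult C_k_const del: C_k.simps)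

text \<open>The flat function exp(-1/t) times a polynomial in 1/t. Carrying the polynomial along
  makes the class closed under differentiation, so smoothness follows by induction.\<close>

definition flat_exp :: "real poly \<Rightarrow> real \<Rightarrow> real" where
  "flat_exp q t = (if t > 0 then poly q (1 / t) * exp (- 1 / t) else 0)"

lemma tendsto_poly_mult_exp_at_top: "((\<lambda>s. poly q s * exp (- s)) \<longlongrightarrow> (0::real)) at_top"
proof -
  have "((\<lambda>s. \<Sum>i\<le>degree q. coeff q i * (s ^ i / exp s)) \<longlongrightarrow> (\<Sum>i\<le>degree q. coeff q i * 0)) at_top"
    by (intro tendsto_intros tendsto_power_div_exp_0)
  then show ?thesis
    by (simp add: poly_altdef sum_divide_distrib exp_minus divide_inverse[symmetric])
qed

text \<open>For positive \<open>t\<close>, differentiating q(1/t) exp(-1/t) gives (q - q')(1/t) /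
  t^2 times exp(-1/t), and \<open>[:0, 0, 1:]\<close> encodes the factor 1/t^2. At 0 the exponential
  beats every polynomial.\<close>

lemma flat_exp_has_derivative:
  "(flat_exp q has_real_derivative flat_exp ([:0, 0, 1:] * (q - pderiv q)) t) (at t)"
proof -
  consider "t > 0" | "t < 0" | "t = 0" by linarith
  then show ?thesis
  proof cases
    case 1
    have "((\<lambda>t. poly q (1 / t) * exp (- 1 / t)) has_real_derivative
        flat_exp ([:0, 0, 1:] * (q - pderiv q)) t) (at t)"
      using 1 by (auto intro!: derivative_eq_intros DERIV_chain2[OF poly_DERIV]
          simp: flat_exp_def field_simps power2_eq_square)
    then show ?thesis
      by (rule has_field_derivative_transform_within_open[of _ _ _ "{0<..}"]) (use 1 in \<open>auto simp: flat_exp_def\<close>)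
  next
    case 2
    have "((\<lambda>t. 0) has_real_derivative flat_exp ([:0, 0, 1:] * (q - pderiv q)) t) (at t)"
      using 2 by (simp add: flat_exp_def)
    then show ?thesis
      by (rule has_field_derivative_transform_within_open[of _ _ _ "{..<0}"]) (use 2 in \<open>auto simp: flat_exp_def\<close>)
  next
    case 3
    \<comment> \<open>The right difference quotient at 0 is q(1/h) exp(-1/h) / h;
      \<open>pCons 0 q\<close> supplies the factor 1/h.\<close>
    have "((\<lambda>h. poly (pCons 0 q) (inverse h) * exp (- inverse h)) \<longlongrightarrow> 0) (at_right 0)"
      using filterlim_compose[OF tendsto_poly_mult_exp_at_top filterlim_inverse_at_top_right] .
    moreover have "\<forall>\<^sub>F h in at_right 0. poly (pCons 0 q) (inverse h) * exp (- inverse h) = (flat_exp q (0 + h) - flat_exp q 0) / h"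
      by (auto simp: eventually_at_filter flat_exp_def field_simps intro!: always_eventually)
    ultimately have "((\<lambda>h. (flat_exp q (0 + h) - flat_exp q 0) / h) \<longlongrightarrow> 0) (at_right 0)"
      by (rule Lim_transform_eventually)
    moreover have "((\<lambda>h. (flat_exp q (0 + h) - flat_exp q 0) / h) \<longlongrightarrow> 0) (at_left 0)"
      by (rule Lim_transform_eventually[OF tendsto_const])
         (auto simp: eventually_at_filter flat_exp_def intro!: always_eventually)
    ultimately have "((\<lambda>h. (flat_exp q (0 + h) - flat_exp q 0) / h) \<longlongrightarrow> 0) (at 0)"
      by (intro filterlim_split_at)
    then show ?thesis using 3 by (simp add: DERIV_def flat_exp_def)
  qed
qed

lemma C_k_flat_exp: "C_k k (\<lambda>x. flat_exp q (x \<bullet> v - a))"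
proof (induction k arbitrary: q)
  case 0
  have "continuous_on UNIV (flat_exp q)"
    using flat_exp_has_derivative by (rule DERIV_continuous_on)
  then have "continuous_on UNIV (\<lambda>x. flat_exp q (x \<bullet> v - a))"
    by (rule continuous_on_compose2) (intro continuous_intros, rule subset_UNIV)
  then show ?case by simp
next
  case (Suc k)
  let ?q = "[:0, 0, 1:] * (q - pderiv q)"
  show ?case
  proof (rule C_k_SucI)
    fix x
    have "((\<lambda>x. x \<bullet> v - a) has_derivative (\<lambda>h. h \<bullet> v)) (at x)"
      by (auto intro!: derivative_eq_intros)
    then show "((\<lambda>x. flat_exp q (x \<bullet> v - a)) has_derivative (\<lambda>h. flat_exp ?q (x \<bullet> v - a) * (h \<bullet> v))) (at x)"
      by (rule has_derivative_compose) (rule flat_exp_has_derivative[unfolded has_field_derivative_def])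
  next
    show "C_k k (\<lambda>x. flat_exp ?q (x \<bullet> v - a) * (i \<bullet> v))" for i
      by (rule C_k_mult[OF Suc.IH C_k_const])
  qed
qed

text \<open>Each factor vanishes beyond one face of the box. The parameter \<open>n\<close>
  stretches the arguments, so at a point of the open box every factor tends to 1.\<close>

definition box_bump :: "nat \<Rightarrow> 'a::euclidean_space \<Rightarrow> 'a \<Rightarrow> 'a \<Rightarrow> real" where
  "box_bump n a b x = (\<Prod>i\<in>Basis. flat_exp 1 (n * (x \<bullet> i - a \<bullet> i)) * flat_exp 1 (n * (b \<bullet> i - x \<bullet> i)))"

lemma flat_exp_1_bounds: "0 \<le> flat_exp 1 t" "flat_exp 1 t \<le> 1" "flat_exp 1 t \<noteq> 0 \<longleftrightarrow> t > 0"
  by (auto simp: flat_exp_def)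

lemma box_bump_bounds: "0 \<le> box_bump n a b x" "box_bump n a b x \<le> 1"
  unfolding box_bump_def
  by (intro prod_nonneg prod_le_1 ballI conjI mult_nonneg_nonneg mult_le_one flat_exp_1_bounds)+

lemma box_bump_eq_0:
  assumes "x \<notin> box a b"
  shows "box_bump n a b x = 0"
proof -
  obtain i where i: "i \<in> Basis" "\<not> (a \<bullet> i < x \<bullet> i \<and> x \<bullet> i < b \<bullet> i)"
    using assms by (auto simp: box_def)
  then have "flat_exp 1 (n * (x \<bullet> i - a \<bullet> i)) * flat_exp 1 (n * (b \<bullet> i - x \<bullet> i)) = 0"
    by (auto simp: flat_exp_def zero_less_mult_iff)
  then show ?thesis unfolding box_bump_def using i(1) by (intro prod_zero) auto
qed

lemma box_bump_translate: "box_bump n a b (x + h) = box_bump n (a - h) (b - h) x"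
  unfolding box_bump_def by (intro prod.cong refl) (simp add: inner_add_left inner_diff_left add_diff_eq diff_diff_eq2 diff_diff_eq add.commute)

lemma box_bump_tendsto:
  fixes x :: "'a::euclidean_space"
  shows "(\<lambda>n. box_bump n a b x) \<longlonglongrightarrow> indicator (box a b) x"
proof (cases "x \<in> box a b")
  case True
  have *: "(\<lambda>n. flat_exp 1 (real n * t)) \<longlonglongrightarrow> 1" if "t > 0" for t
  proof -
    have "(\<lambda>n. exp (- (1 / t) * inverse (real n))) \<longlonglongrightarrow> exp (- (1 / t) * 0)"
      by (intro tendsto_intros lim_inverse_n)
    moreover have "\<forall>\<^sub>F n in sequentially. exp (- (1 / t) * inverse (real n)) = flat_exp 1 (real n * t)"
      using eventually_gt_at_top[of 0] by eventually_elim (use that in \<open>auto simp: flat_exp_def field_simps\<close>)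
    ultimately show ?thesis by (simp add: Lim_transform_eventually)
  qed
  have "(\<lambda>n. box_bump n a b x) \<longlonglongrightarrow> (\<Prod>i\<in>(Basis :: 'a set). 1 * 1)"
    unfolding box_bump_def using True by (intro tendsto_prod tendsto_mult *) (auto simp: box_def)
  then show ?thesis using True by simp
qed (simp add: box_bump_eq_0)

lemma C_k_box_bump: "C_k k (box_bump n a b)"
proof -
  have "C_k k (\<lambda>x. \<Prod>i\<in>Basis. flat_exp 1 (x \<bullet> (real n *\<^sub>R i) - real n * (a \<bullet> i)) * flat_exp 1 (x \<bullet> (- real n *\<^sub>R i) - (- real n * (b \<bullet> i))))"
    by (intro C_k_prod C_k_mult C_k_flat_exp)
  then show ?thesis unfolding box_bump_def[abs_def] by (simp add: algebra_simps)
qed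

lemma test_function_box_bump: "test_function (box_bump n a b)"
proof -
  have "{x. box_bump n a b x \<noteq> 0} \<subseteq> cbox a b"
    using box_bump_eq_0[of _ a b n] box_subset_cbox[of a b] by blast
  then have "bounded (closure {x. box_bump n a b x \<noteq> 0})"
    using bounded_cbox bounded_closure bounded_subset by blast
  then show ?thesis by (simp add: test_function_def C_k_box_bump compact_eq_bounded_closed)
qed

subsection \<open>Difference quotients and weak gradients\<close>

text \<open>The positive and negative parts of \<open>w\<close> are densities of two measures,
  finite and equal on boxes. Boxes form an intersection-stable generator, so the measures and hence
  the densities agree.\<close>

lemma AE_eq_0_if_integral_box_eq_0:
  fixes w :: "'a::euclidean_space \<Rightarrow> real"
  assumes int: "\<And>a b. integrable lborel (\<lambda>x. indicator (box a b) x * w x)"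
    and zero: "\<And>a b. (\<integral>x. indicator (box a b) x * w x \<partial>lborel) = 0"
    and w[measurable]: "w \<in> borel_measurable borel"
  shows "AE x in lborel. w x = 0"
proof -
  have box: "emeasure (density lborel (\<lambda>x. ennreal (w x))) (box a b) = emeasure (density lborel (\<lambda>x. ennreal (- w x))) (box a b)"
    and fin: "emeasure (density lborel (\<lambda>x. ennreal (w x))) (box a b) < \<infinity>" for a b
  proof -
    let ?p = "\<integral>\<^sup>+x. ennreal (indicator (box a b) x * w x) \<partial>lborel"
    let ?n = "\<integral>\<^sup>+x. ennreal (- (indicator (box a b) x * w x)) \<partial>lborel"
    have pn: "?p < \<infinity>" "?n < \<infinity>" using int[of a b] by (simp_all add: real_integrable_def less_top)
    have "enn2real ?p = enn2real ?n"
      using zero[of a b] real_lebesgue_integral_def[OF int[of a b]] by simp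
    with pn have "?p = ?n" by (cases ?p; cases ?n) auto
    moreover have "emeasure (density lborel (\<lambda>x. ennreal (w x))) (box a b) = ?p"
      by (subst emeasure_density) (auto intro!: nn_integral_cong split: split_indicator)
    moreover have "emeasure (density lborel (\<lambda>x. ennreal (- w x))) (box a b) = ?n"
      by (subst emeasure_density) (auto intro!: nn_integral_cong split: split_indicator)
    ultimately show "emeasure (density lborel (\<lambda>x. ennreal (w x))) (box a b) = emeasure (density lborel (\<lambda>x. ennreal (- w x))) (box a b)"
      "emeasure (density lborel (\<lambda>x. ennreal (w x))) (box a b) < \<infinity>" using pn by simp_all
  qed
  have "density lborel (\<lambda>x. ennreal (w x)) = density lborel (\<lambda>x. ennreal (- w x))"
  proof (rule measure_eqI_generator_eq)
    let ?E = "range (\<lambda>(a, b). box a b :: 'a set)"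
    show "Int_stable ?E" by (auto simp: Int_stable_def box_Int_box)
    show "?E \<subseteq> Pow UNIV" "sets (density lborel (\<lambda>x. ennreal (w x))) = sigma_sets UNIV ?E"
      "sets (density lborel (\<lambda>x. ennreal (- w x))) = sigma_sets UNIV ?E"
      by (simp_all add: borel_eq_box)
    let ?A = "\<lambda>n::nat. box (- (real n *\<^sub>R One)) (real n *\<^sub>R One) :: 'a set"
    show "range ?A \<subseteq> ?E" "(\<Union>i. ?A i) = UNIV" unfolding UN_box_eq_UNIV by auto
    show "emeasure (density lborel (\<lambda>x. ennreal (w x))) (?A i) \<noteq> \<infinity>" for i
      using fin[of "- (real i *\<^sub>R One)" "real i *\<^sub>R One"] by (simp add: less_top)
    show "emeasure (density lborel (\<lambda>x. ennreal (w x))) X = emeasure (density lborel (\<lambda>x. ennreal (- w x))) X"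
      if "X \<in> ?E" for X using that box by auto
  qed
  \<comment> \<open>\<open>ennreal\<close> sends negative reals to 0, so these are the positive and
    negative parts. At each point one of them is 0, so equality forces both to vanish.\<close>
  then have "AE x in lborel. ennreal (w x) = ennreal (- w x)"
    by (intro sigma_finite_measure.density_unique[OF sigma_finite_lborel]) auto
  then show ?thesis
  proof eventually_elim
    case (elim x)
    then show ?case by (cases "0 \<le> w x") (auto simp: ennreal_neg)
  qed
qed

text \<open>The left side is the tangent at \<open>t\<close> of the convex function
  \<open>y powr p\<close>. For \<open>p > 1\<close> the bound is Young's inequality with the
  conjugate exponent \<open>q\<close>.\<close>

lemma powr_ge_tangent:
  fixes y t p :: real
  assumes "1 \<le> p" "0 \<le> y" "0 < t"
  shows "p * t powr (p - 1) * y - (p - 1) * t powr p \<le> y powr p"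
proof (cases "p = 1")
  case False
  then have p: "1 < p" using assms by simp
  define q where "q = p / (p - 1)"
  have q: "1 < q" "1 / p + 1 / q = 1" "(p - 1) * q = p" using p by (auto simp: q_def field_simps)
  have "y * t powr (p - 1) \<le> y powr p / p + (t powr (p - 1)) powr q / q"
    using p q assms by (intro Youngs_inequality) auto
  also have "(t powr (p - 1)) powr q / q = (p - 1) * t powr p / p"
    using q(3) by (simp add: powr_powr q_def)
  finally show ?thesis using p by (simp add: field_simps)
qed (use assms in simp)

text \<open>Jensen's inequality on a probability space: integrate the tangent bound taken at the
  mean \<open>t\<close> of the absolute value.\<close>

lemma powr_abs_integral_unit_interval_le:
  fixes f :: "real \<Rightarrow> real"
  assumes p: "1 \<le> p" and f[measurable]: "f \<in> borel_measurable borel"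
  shows "ennreal (\<bar>\<integral>s. indicator {0..1} s * f s \<partial>lborel\<bar> powr p)
           \<le> (\<integral>\<^sup>+s. indicator {0..1} s * ennreal (\<bar>f s\<bar> powr p) \<partial>lborel)"
proof -
  let ?F = "\<lambda>s. indicator {0..1} s * \<bar>f s\<bar> :: real" and ?P = "\<lambda>s. indicator {0..1} s * \<bar>f s\<bar> powr p :: real"
  define t where "t = (\<integral>s. ?F s \<partial>lborel)"
  have abs: "\<bar>\<integral>s. indicator {0..1} s * f s \<partial>lborel\<bar> \<le> t"
    unfolding t_def using integral_norm_bound[of lborel "\<lambda>s. indicator {0..1} s * f s"] by (simp add: abs_mult)
  have rhs: "(\<integral>\<^sup>+s. indicator {0..1} s * ennreal (\<bar>f s\<bar> powr p) \<partial>lborel) = (\<integral>\<^sup>+s. ennreal (?P s) \<partial>lborel)"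
    by (intro nn_integral_cong) (auto split: split_indicator)
  show ?thesis
  proof (cases "0 < t \<and> (\<integral>\<^sup>+s. ennreal (?P s) \<partial>lborel) < \<infinity>")
    case True
    then have t: "0 < t" and fin: "(\<integral>\<^sup>+s. ennreal (?P s) \<partial>lborel) < \<infinity>" by auto
    \<comment> \<open>A nonintegrable function has Bochner integral 0, so a positive
      \<open>t\<close> forces integrability.\<close>
    have intF: "integrable lborel ?F" using t not_integrable_integral_eq unfolding t_def by force
    have intP: "integrable lborel ?P" using fin by (intro integrableI_nonneg) auto
    have int1: "integrable lborel (\<lambda>s::real. indicator {0..1} s :: real)" using emeasure_lborel_Icc[of 0 1] by (simp add: integrable_indicator_iff)
    have "p * t powr (p - 1) * t - (p - 1) * t powr p
       = (\<integral>s. p * t powr (p - 1) * ?F s - (p - 1) * t powr p * indicator {0..1} s \<partial>lborel)"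
      using intF int1 by (simp add: t_def)
    also have "\<dots> \<le> (\<integral>s. ?P s \<partial>lborel)"
    proof (rule integral_mono)
      show "p * t powr (p - 1) * ?F s - (p - 1) * t powr p * indicator {0..1} s \<le> ?P s" for s
        using powr_ge_tangent[OF p abs_ge_zero t, of "f s"] by (simp split: split_indicator)
    qed (use intF int1 intP in auto)
    also have "p * t powr (p - 1) * t - (p - 1) * t powr p = t powr p"
      using t by (simp add: powr_diff field_simps)
    finally have "ennreal (t powr p) \<le> ennreal (\<integral>s. ?P s \<partial>lborel)" by (rule ennreal_leI)
    also have "\<dots> = (\<integral>\<^sup>+s. ennreal (?P s) \<partial>lborel)"
      using intP by (intro nn_integral_eq_integral[symmetric]) auto
    finally have "ennreal (t powr p) \<le> (\<integral>\<^sup>+s. ennreal (?P s) \<partial>lborel)" .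
    moreover have "ennreal (\<bar>\<integral>s. indicator {0..1} s * f s \<partial>lborel\<bar> powr p) \<le> ennreal (t powr p)"
      using abs p by (intro ennreal_leI powr_mono2) auto
    ultimately show ?thesis unfolding rhs by (rule order.trans[rotated])
  next
    case False
    then consider "t \<le> 0" | "(\<integral>\<^sup>+s. ennreal (?P s) \<partial>lborel) = \<infinity>" by (auto simp: not_less top_unique)
    then show ?thesis
    proof cases
      case 1
      then have "(\<integral>s. indicator {0..1} s * f s \<partial>lborel) = 0" using abs by linarith
      then show ?thesis by simp
    qed (simp add: rhs)
  qed
qed

lemma integrable_mult_bounded_support:
  fixes u m :: "'a::euclidean_space \<Rightarrow> real"
  assumes u: "integrable lborel (\<lambda>x. indicator K x * u x)"
    and [measurable]: "u \<in> borel_measurable borel" "m \<in> borel_measurable borel"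
    and m: "\<And>x. \<bar>m x\<bar> \<le> C * indicator K x"
  shows "integrable lborel (\<lambda>x. u x * m x)"
proof (rule Bochner_Integration.integrable_bound)
  show "integrable lborel (\<lambda>x. C * (indicator K x * u x))" using u by simp
  show "AE x in lborel. norm (u x * m x) \<le> norm (C * (indicator K x * u x))"
  proof (intro AE_I2)
    fix x
    have "\<bar>u x\<bar> * \<bar>m x\<bar> \<le> \<bar>u x\<bar> * (\<bar>C\<bar> * indicator K x)"
      using m[of x] by (intro mult_left_mono order.trans[OF m]) (auto split: split_indicator)
    then show "norm (u x * m x) \<le> norm (C * (indicator K x * u x))"
      by (simp add: abs_mult mult_ac)
  qed
qed simp

lemma nn_integral_lborel_translate:
  fixes k :: "'a::euclidean_space"
  assumes [measurable]: "f \<in> borel_measurable borel"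
  shows "(\<integral>\<^sup>+x. f (x + k) \<partial>lborel) = (\<integral>\<^sup>+x. f x \<partial>lborel)"
proof -
  have "(\<integral>\<^sup>+x. f x \<partial>lborel) = (\<integral>\<^sup>+x. f x \<partial>distr lborel borel ((+) k))" by (simp add: lborel_distr_plus)
  also have "\<dots> = (\<integral>\<^sup>+x. f (x + k) \<partial>lborel)" by (simp add: nn_integral_distr add.commute)
  finally show ?thesis by simp
qed

lemma
  fixes k :: "'a::euclidean_space" and f :: "'a \<Rightarrow> real"
  assumes [measurable]: "f \<in> borel_measurable borel"
  shows lebesgue_integral_lborel_translate: "(\<integral>x. f (x + k) \<partial>lborel) = (\<integral>x. f x \<partial>lborel)"
    and integrable_lborel_translate_iff: "integrable lborel (\<lambda>x. f (x + k)) \<longleftrightarrow> integrable lborel f"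
proof -
  have "(\<integral>x. f x \<partial>lborel) = (\<integral>x. f x \<partial>distr lborel borel ((+) k))" by (simp add: lborel_distr_plus)
  also have "\<dots> = (\<integral>x. f (x + k) \<partial>lborel)" by (simp add: integral_distr add.commute)
  finally show "(\<integral>x. f (x + k) \<partial>lborel) = (\<integral>x. f x \<partial>lborel)" by simp
  have "integrable lborel f \<longleftrightarrow> integrable (distr lborel borel ((+) k)) f" by (simp add: lborel_distr_plus)
  also have "\<dots> \<longleftrightarrow> integrable lborel (\<lambda>x. f (x + k))" by (simp add: integrable_distr_eq add.commute)
  finally show "integrable lborel (\<lambda>x. f (x + k)) \<longleftrightarrow> integrable lborel f" by simp
qed

section \<open>Derivatives of the bumps\<close>

abbreviation box_bump_deriv :: "nat \<Rightarrow> 'a::euclidean_space \<Rightarrow> 'a \<Rightarrow> 'a \<Rightarrow> 'a \<Rightarrow> real" where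
  "box_bump_deriv n a b x \<equiv> frechet_derivative (box_bump n a b) (at x)"

lemma box_bump_has_derivative: "(box_bump n a b has_derivative box_bump_deriv n a b x) (at x)"
  using C_k_box_bump[of "Suc 0" n a b] by (rule C_k_Suc_has_derivative)

lemma continuous_on_box_bump: "continuous_on S (box_bump n a b)"
  using C_k_box_bump[of 0 n a b] by (auto intro: continuous_on_subset)

text \<open>Smoothness and the weak gradient are formulated in basis directions only; linearity
  extends them to an arbitrary \<open>h\<close>.\<close>

lemma box_bump_deriv_eq_sum:
  "box_bump_deriv n a b x h = (\<Sum>i\<in>Basis. (h \<bullet> i) * box_bump_deriv n a b x i)"
proof -
  have lin: "linear (box_bump_deriv n a b x)"
    using box_bump_has_derivative by (rule has_derivative_linear)
  have "box_bump_deriv n a b x h = box_bump_deriv n a b x (\<Sum>i\<in>Basis. (h \<bullet> i) *\<^sub>R i)"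
    by (simp add: euclidean_representation)
  also have "\<dots> = (\<Sum>i\<in>Basis. (h \<bullet> i) * box_bump_deriv n a b x i)"
    using lin by (simp add: linear_sum linear_cmul)
  finally show ?thesis .
qed

lemma continuous_on_box_bump_deriv: "continuous_on S (\<lambda>x. box_bump_deriv n a b x h)"
proof -
  have "continuous_on UNIV (\<lambda>x. box_bump_deriv n a b x i)" if "i \<in> Basis" for i
    using C_k_box_bump[of "Suc 0" n a b] that by simp
  then have "continuous_on UNIV (\<lambda>x. \<Sum>i\<in>Basis. (h \<bullet> i) * box_bump_deriv n a b x i)"
    by (intro continuous_intros) auto
  then show ?thesis unfolding box_bump_deriv_eq_sum[of n a b _ h, abs_def]
    by (rule continuous_on_subset) simp
qed

lemma box_bump_deriv_eq_0:
  assumes "x \<notin> cbox a b"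
  shows "box_bump_deriv n a b x h = 0"
proof -
  have "((\<lambda>x. 0) has_derivative (\<lambda>h. 0)) (at x)" by simp
  then have "(box_bump n a b has_derivative (\<lambda>h. 0)) (at x)"
    by (rule has_derivative_transform_within_open[of _ _ _ _ "- cbox a b"])
       (use assms box_subset_cbox[of a b] in \<open>auto simp: box_bump_eq_0 closed_cbox subset_eq\<close>)
  then show ?thesis by (metis frechet_derivative_at)
qed

lemma box_bump_deriv_bounded: "\<exists>C. \<forall>x. \<bar>box_bump_deriv n a b x h\<bar> \<le> C * indicator (cbox a b) x"
proof -
  have "compact ((\<lambda>x. box_bump_deriv n a b x h) ` cbox a b)"
    by (intro compact_continuous_image continuous_on_box_bump_deriv compact_cbox)
  then obtain C where "\<And>x. x \<in> cbox a b \<Longrightarrow> \<bar>box_bump_deriv n a b x h\<bar> \<le> C"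
    unfolding bounded_iff by (metis (mono_tags, lifting) bounded_iff compact_imp_bounded image_eqI real_norm_def)
  then have "\<forall>x. \<bar>box_bump_deriv n a b x h\<bar> \<le> C * indicator (cbox a b) x"
    by (auto simp: box_bump_deriv_eq_0 split: split_indicator)
  then show ?thesis by blast
qed

lemma box_bump_deriv_translate:
  "box_bump_deriv n (a - k) (b - k) x = box_bump_deriv n a b (x + k)"
proof -
  have "((\<lambda>x. x + k) has_derivative (\<lambda>h. h)) (at x)" by (auto intro!: derivative_eq_intros)
  then have "((\<lambda>x. box_bump n a b (x + k)) has_derivative (\<lambda>h. box_bump_deriv n a b (x + k) h)) (at x)"
    by (rule has_derivative_compose) (rule box_bump_has_derivative)
  then have "(box_bump n (a - k) (b - k) has_derivative box_bump_deriv n a b (x + k)) (at x)"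
    by (simp add: box_bump_translate)
  then show ?thesis using frechet_derivative_at by metis
qed

lemma box_bump_borel [measurable]: "box_bump n a b \<in> borel_measurable borel"
  by (rule borel_measurable_continuous_onI) (rule continuous_on_box_bump)

lemma box_bump_deriv_borel [measurable]: "(\<lambda>x. box_bump_deriv n a b x h) \<in> borel_measurable borel"
  by (rule borel_measurable_continuous_onI) (rule continuous_on_box_bump_deriv)

text \<open>Fundamental theorem of calculus along the segment from \<open>x\<close> to
  \<open>x - h\<close>. The shift is backward because a change of variables will move it from
  \<open>u\<close> to the bump.\<close>

lemma box_bump_diff_eq_integral:
  "box_bump n a b (x - h) - box_bump n a b x
     = - (\<integral>s. indicator {0..1} s * box_bump_deriv n a b (x - s *\<^sub>R h) h \<partial>lborel)"
proof -
  define F where "F s = box_bump n a b (x - s *\<^sub>R h)" for s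
  have "(\<integral>s. - box_bump_deriv n a b (x - s *\<^sub>R h) h * indicator {0..1} s \<partial>lborel) = F 1 - F 0"
  proof (rule integral_FTC_Icc_real)
    fix s :: real
    have "((\<lambda>s. x - s *\<^sub>R h) has_derivative (\<lambda>t. - t *\<^sub>R h)) (at s)"
      by (auto intro!: derivative_eq_intros)
    then have "(F has_derivative (\<lambda>t. box_bump_deriv n a b (x - s *\<^sub>R h) (- t *\<^sub>R h))) (at s)"
      unfolding F_def by (rule has_derivative_compose) (rule box_bump_has_derivative)
    moreover have "linear (box_bump_deriv n a b (x - s *\<^sub>R h))"
      using box_bump_has_derivative by (rule has_derivative_linear)
    moreover have "(*) (- box_bump_deriv n a b (x - s *\<^sub>R h) h) = (\<lambda>t. - (t * box_bump_deriv n a b (x - s *\<^sub>R h) h))"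
      by auto
    ultimately show "(F has_real_derivative - box_bump_deriv n a b (x - s *\<^sub>R h) h) (at s)"
      by (simp add: has_field_derivative_def linear_cmul linear_neg)
    have "continuous_on UNIV (\<lambda>s. box_bump_deriv n a b (x - s *\<^sub>R h) h)"
      by (rule continuous_on_compose2[OF continuous_on_box_bump_deriv[of UNIV]]) (intro continuous_intros, rule subset_UNIV)
    then have "isCont (\<lambda>s. box_bump_deriv n a b (x - s *\<^sub>R h) h) s"
      by (simp add: continuous_on_eq_continuous_at)
    then show "isCont (\<lambda>s. - box_bump_deriv n a b (x - s *\<^sub>R h) h) s"
      by (rule continuous_minus)
  qed simp
  then show ?thesis by (simp add: F_def mult.commute[of "indicator _ _"])
qed

text \<open>Borel versions of a function and its weak gradient; test functions are restricted to bumps.\<close>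

locale borel_weak_gradient =
  fixes u :: "'a::euclidean_space \<Rightarrow> real" and g :: "'a \<Rightarrow> 'a"
  assumes u_borel [measurable]: "u \<in> borel_measurable borel"
    and g_borel [measurable]: "g \<in> borel_measurable borel"
    and u_integrable: "integrable lborel (\<lambda>x. indicator (cbox a b) x * u x)"
    and g_integrable: "integrable lborel (\<lambda>x. indicator (cbox a b) x * norm (g x))"
    and weak: "i \<in> Basis \<Longrightarrow>
      (\<integral>x. u x * box_bump_deriv n a b x i \<partial>lborel) = - (\<integral>x. (g x \<bullet> i) * box_bump n a b x \<partial>lborel)"
begin

lemma u_mult_integrable:
  "m \<in> borel_measurable borel \<Longrightarrow> (\<And>x. \<bar>m x\<bar> \<le> C * indicator (cbox a b) x) \<Longrightarrow> integrable lborel (\<lambda>x. u x * m x)"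
  by (rule integrable_mult_bounded_support[OF u_integrable u_borel])

lemma g_mult_integrable:
  assumes [measurable]: "m \<in> borel_measurable borel" and m: "\<And>x. \<bar>m x\<bar> \<le> C * indicator (cbox a b) x"
  shows "integrable lborel (\<lambda>x. (g x \<bullet> h) * m x)"
proof (rule Bochner_Integration.integrable_bound)
  show "integrable lborel (\<lambda>x. norm h * (norm (g x) * m x))"
    using integrable_mult_bounded_support[OF g_integrable, OF _ assms] by simp
  show "AE x in lborel. norm ((g x \<bullet> h) * m x) \<le> norm (norm h * (norm (g x) * m x))"
  proof (intro AE_I2)
    fix x
    have "\<bar>g x \<bullet> h\<bar> * \<bar>m x\<bar> \<le> (norm (g x) * norm h) * \<bar>m x\<bar>"
      by (intro mult_right_mono Cauchy_Schwarz_ineq2) simp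
    then show "norm ((g x \<bullet> h) * m x) \<le> norm (norm h * (norm (g x) * m x))"
      by (simp add: abs_mult mult_ac)
  qed
qed simp

lemma box_bump_abs_le: "\<bar>box_bump n a b x\<bar> \<le> 1 * indicator (cbox a b) x"
  using box_bump_bounds[of n a b x] box_bump_eq_0[of x a b n] box_subset_cbox[of a b]
  by (auto split: split_indicator)

lemma weak_direction:
  "(\<integral>x. u x * box_bump_deriv n a b x h \<partial>lborel) = - (\<integral>x. (g x \<bullet> h) * box_bump n a b x \<partial>lborel)"
proof -
  have 1: "integrable lborel (\<lambda>x. u x * box_bump_deriv n a b x i)" for i
    using box_bump_deriv_bounded[of n a b i] u_mult_integrable[OF box_bump_deriv_borel] by blast
  have 2: "integrable lborel (\<lambda>x. (g x \<bullet> i) * box_bump n a b x)" for i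
    by (rule g_mult_integrable[OF box_bump_borel box_bump_abs_le])
  have gh: "g x \<bullet> h = (\<Sum>i\<in>Basis. (h \<bullet> i) * (g x \<bullet> i))" for x
    by (subst euclidean_inner) (simp add: mult.commute)
  have "(\<integral>x. u x * box_bump_deriv n a b x h \<partial>lborel)
      = (\<integral>x. (\<Sum>i\<in>Basis. (h \<bullet> i) * (u x * box_bump_deriv n a b x i)) \<partial>lborel)"
    unfolding box_bump_deriv_eq_sum[of n a b _ h] by (simp add: sum_distrib_left mult_ac)
  also have "\<dots> = (\<Sum>i\<in>Basis. (h \<bullet> i) * (\<integral>x. u x * box_bump_deriv n a b x i \<partial>lborel))"
    using 1 by (subst Bochner_Integration.integral_sum) auto
  also have "\<dots> = - (\<Sum>i\<in>Basis. (h \<bullet> i) * (\<integral>x. (g x \<bullet> i) * box_bump n a b x \<partial>lborel))"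
    by (simp add: weak sum_negf)
  also have "(\<Sum>i\<in>Basis. (h \<bullet> i) * (\<integral>x. (g x \<bullet> i) * box_bump n a b x \<partial>lborel))
      = (\<integral>x. (\<Sum>i\<in>Basis. (h \<bullet> i) * ((g x \<bullet> i) * box_bump n a b x)) \<partial>lborel)"
    using 2 by (subst Bochner_Integration.integral_sum) auto
  also have "\<dots> = (\<integral>x. (g x \<bullet> h) * box_bump n a b x \<partial>lborel)"
    unfolding gh by (simp add: sum_distrib_right sum_distrib_left mult_ac)
  finally show ?thesis .
qed

text \<open>For a smooth function with gradient \<open>g\<close> this is the increment from
  \<open>x\<close> to \<open>x + h\<close>.\<close>

definition mean_gradient :: "'a \<Rightarrow> 'a \<Rightarrow> real" where
  "mean_gradient h x = (\<integral>s. indicator {0..1} s * (g (x + s *\<^sub>R h) \<bullet> h) \<partial>lborel)"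

lemma mean_gradient_borel [measurable]: "mean_gradient h \<in> borel_measurable borel"
  unfolding mean_gradient_def[abs_def] by measurable

text \<open>A shift by \<open>s *\<^sub>R h\<close> moves each coordinate by at most
  \<open>norm h\<close>, so one enlarged box contains the translated supports for all
  \<open>s\<close> at once.\<close>

lemma translated_bound:
  fixes m :: "'a \<Rightarrow> real"
  assumes "\<And>x. \<bar>m x\<bar> \<le> C * indicator (cbox a b) x" and "s \<in> {0..1::real}"
  shows "\<bar>m (x - s *\<^sub>R h)\<bar> \<le> \<bar>C\<bar> * indicator (cbox (a - norm h *\<^sub>R One) (b + norm h *\<^sub>R One)) (x :: 'a)"
proof -
  have "x \<in> cbox (a - norm h *\<^sub>R One) (b + norm h *\<^sub>R One)" if "x - s *\<^sub>R h \<in> cbox a b"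
    unfolding mem_box
  proof (intro ballI)
    fix i :: 'a assume i: "i \<in> Basis"
    have "\<bar>s * (h \<bullet> i)\<bar> \<le> 1 * norm h"
      using assms(2) i unfolding abs_mult by (intro mult_mono Basis_le_norm) auto
    moreover have "a \<bullet> i \<le> x \<bullet> i - s * (h \<bullet> i)" "x \<bullet> i - s * (h \<bullet> i) \<le> b \<bullet> i"
      using that i by (auto simp: mem_box inner_diff_left)
    ultimately show "(a - norm h *\<^sub>R One) \<bullet> i \<le> x \<bullet> i \<and> x \<bullet> i \<le> (b + norm h *\<^sub>R One) \<bullet> i"
      using i by (auto simp: inner_diff_left inner_add_left abs_le_iff)
  qed
  then show ?thesis using assms(1)[of "x - s *\<^sub>R h"]
    by (cases "x - s *\<^sub>R h \<in> cbox a b") auto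
qed

lemma integrable_indicator_01: "integrable lborel (\<lambda>s. c * indicator {0..1::real} s :: real)"
  using emeasure_lborel_Icc[of 0 1] by (simp add: integrable_indicator_iff)

text \<open>Justifies the first use of Fubini's theorem: the integrand is dominated by a product of
  an integrable function of \<open>x\<close> and the indicator of the unit interval.\<close>

lemma integrable_product_u:
  "integrable (lborel \<Otimes>\<^sub>M lborel) (\<lambda>(x, s). u x * (indicator {0..1::real} s * box_bump_deriv n a b (x - s *\<^sub>R h) h))"
proof -
  obtain C where C: "\<And>x. \<bar>box_bump_deriv n a b x h\<bar> \<le> C * indicator (cbox a b) x"
    using box_bump_deriv_bounded by blast
  let ?K = "cbox (a - norm h *\<^sub>R One) (b + norm h *\<^sub>R One)"
  have bound: "\<bar>u x * (indicator {0..1} s * box_bump_deriv n a b (x - s *\<^sub>R h) h)\<bar>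
      \<le> \<bar>C\<bar> * \<bar>indicator ?K x * u x\<bar> * indicator {0..1} s" for x and s :: real
    using mult_left_mono[OF translated_bound[OF C, of s x h], of "\<bar>u x\<bar>"]
    by (auto simp: abs_mult mult_ac split: split_indicator)
  have prod: "integrable (lborel \<Otimes>\<^sub>M lborel) (\<lambda>(x, s::real). \<bar>C\<bar> * \<bar>indicator ?K x * u x\<bar> * indicator {0..1} s)"
  proof (rule lborel_pair.Fubini_integrable)
    show "integrable lborel (\<lambda>x. \<integral>s. norm (case (x, s) of (x, s) \<Rightarrow> \<bar>C\<bar> * \<bar>indicator ?K x * u x\<bar> * indicator {0..1::real} s) \<partial>lborel)"
      using u_integrable[of "a - norm h *\<^sub>R One" "b + norm h *\<^sub>R One", THEN integrable_abs] by (simp add: abs_mult)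
    show "AE x in lborel. integrable lborel (\<lambda>s::real. case (x, s) of (x, s) \<Rightarrow> \<bar>C\<bar> * \<bar>indicator ?K x * u x\<bar> * indicator {0..1} s)"
      by (intro AE_I2) (simp only: prod.case integrable_indicator_01)
  qed measurable
  have [measurable]: "(\<lambda>p. box_bump_deriv n a b (fst p - snd p *\<^sub>R h) h) \<in> borel_measurable (borel \<Otimes>\<^sub>M borel)"
    by (rule measurable_compose[OF _ box_bump_deriv_borel]) measurable
  show ?thesis
    by (rule Bochner_Integration.integrable_bound[OF prod])
       (measurable, use bound in \<open>auto simp: abs_mult intro!: AE_I2\<close>)
qed

text \<open>Justifies the second use of Fubini's theorem. The shift now acts on \<open>g\<close>, so
  instead of a pointwise bound the \<open>L\<^sup>1\<close> norm in \<open>x\<close> is bounded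
  uniformly in \<open>s\<close>.\<close>

lemma integrable_product_g:
  fixes m :: "'a \<Rightarrow> real"
  assumes [measurable]: "m \<in> borel_measurable borel" and m: "\<And>x. \<bar>m x\<bar> \<le> C * indicator (cbox a b) x"
  shows "integrable (lborel \<Otimes>\<^sub>M lborel) (\<lambda>(s::real, x). indicator {0..1} s * (g (x + s *\<^sub>R h) \<bullet> h) * m x)"
proof (rule lborel_pair.Fubini_integrable)
  let ?K = "cbox (a - norm h *\<^sub>R One) (b + norm h *\<^sub>R One)"
  let ?B = "\<integral>x. \<bar>C\<bar> * norm h * (norm (g x) * indicator ?K x) \<partial>lborel"
  have intB: "integrable lborel (\<lambda>x. \<bar>C\<bar> * norm h * (norm (g x) * indicator ?K x))"
    using g_integrable[of "a - norm h *\<^sub>R One" "b + norm h *\<^sub>R One"] by (simp add: mult.commute)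
  have int: "integrable lborel (\<lambda>x. (g x \<bullet> h) * m (x - s *\<^sub>R h))" if "s \<in> {0..1}" for s :: real
    by (rule g_mult_integrable[OF _ translated_bound[OF m that]]) measurable
  have bound: "(\<integral>x. norm ((g (x + s *\<^sub>R h) \<bullet> h) * m x) \<partial>lborel) \<le> ?B" if s: "s \<in> {0..1}" for s :: real
  proof -
    \<comment> \<open>Translation moves the shift from \<open>g\<close> to the bounded factor
      \<open>m\<close>, whose support stays in the enlarged box.\<close>
    have "(\<integral>x. norm ((g (x + s *\<^sub>R h) \<bullet> h) * m x) \<partial>lborel)
        = (\<integral>x. norm ((g (x + s *\<^sub>R h) \<bullet> h) * m ((x + s *\<^sub>R h) - s *\<^sub>R h)) \<partial>lborel)"
      by simp
    also have "\<dots> = (\<integral>x. norm ((g x \<bullet> h) * m (x - s *\<^sub>R h)) \<partial>lborel)"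
      by (rule lebesgue_integral_lborel_translate[of "\<lambda>x. norm ((g x \<bullet> h) * m (x - s *\<^sub>R h))"]) measurable
    also have "\<dots> \<le> ?B"
    proof (rule integral_mono)
      fix x
      have "\<bar>g x \<bullet> h\<bar> * \<bar>m (x - s *\<^sub>R h)\<bar> \<le> (norm (g x) * norm h) * (\<bar>C\<bar> * indicator ?K x)"
        by (intro mult_mono Cauchy_Schwarz_ineq2 translated_bound[OF m s]) auto
      then show "norm ((g x \<bullet> h) * m (x - s *\<^sub>R h)) \<le> \<bar>C\<bar> * norm h * (norm (g x) * indicator ?K x)"
        by (simp add: abs_mult mult_ac)
    qed (use int[OF s] intB in auto)
    finally show ?thesis .
  qed
  show "integrable lborel (\<lambda>s. \<integral>x. norm (case (s, x) of (s::real, x) \<Rightarrow> indicator {0..1} s * (g (x + s *\<^sub>R h) \<bullet> h) * m x) \<partial>lborel)"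
    (is "integrable lborel ?I")
  proof (rule Bochner_Integration.integrable_bound)
    show "integrable lborel (\<lambda>s. ?B * indicator {0..1::real} s)" by (rule integrable_indicator_01)
    show "?I \<in> borel_measurable lborel" by measurable
    show "AE s in lborel. norm (?I s) \<le> norm (?B * indicator {0..1::real} s)"
    proof (intro AE_I2)
      fix s :: real
      have "0 \<le> ?B" by (intro integral_nonneg_AE AE_I2) simp
      then show "norm (?I s) \<le> norm (?B * indicator {0..1::real} s)"
        using bound[of s] integral_nonneg_AE[of "\<lambda>x. norm ((g (x + s *\<^sub>R h) \<bullet> h) * m x)" lborel]
        by (cases "s \<in> {0..1}") (auto simp: abs_mult)
    qed
  qed
  show "AE s in lborel. integrable lborel (\<lambda>x. case (s, x) of (s::real, x) \<Rightarrow> indicator {0..1} s * (g (x + s *\<^sub>R h) \<bullet> h) * m x)"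
  proof (intro AE_I2)
    fix s :: real
    have "integrable lborel (\<lambda>x. (g (x + s *\<^sub>R h) \<bullet> h) * m x)" if "s \<in> {0..1}"
      using integrable_lborel_translate_iff[of "\<lambda>x. (g x \<bullet> h) * m (x - s *\<^sub>R h)" "s *\<^sub>R h"] int[OF that]
      by simp
    then show "integrable lborel (\<lambda>x. case (s, x) of (s::real, x) \<Rightarrow> indicator {0..1} s * (g (x + s *\<^sub>R h) \<bullet> h) * m x)"
      by (cases "s \<in> {0..1}") (auto simp: mult.assoc)
  qed
qed measurable

text \<open>The shift passes from \<open>u\<close> to the bump, the bump's increment becomes an
  integral of derivatives, and the weak gradient identity is applied for each \<open>s\<close>.
  Translating back and exchanging integrals again assembles the mean gradient.\<close>

lemma integral_difference_box_bump:
  "(\<integral>x. (u (x + h) - u x) * box_bump n a b x \<partial>lborel) = (\<integral>x. mean_gradient h x * box_bump n a b x \<partial>lborel)"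
proof -
  let ?f = "box_bump n a b" and ?D = "\<lambda>x. box_bump_deriv n a b x h"
  have int0: "integrable lborel (\<lambda>x. u x * ?f x)"
    by (rule u_mult_integrable[OF box_bump_borel box_bump_abs_le])
  have int1: "integrable lborel (\<lambda>x. u x * ?f (x - h))"
  proof (rule u_mult_integrable)
    show "\<bar>?f (x - h)\<bar> \<le> \<bar>1\<bar> * indicator (cbox (a - norm h *\<^sub>R One) (b + norm h *\<^sub>R One)) x" for x
      using translated_bound[where m="?f" and s=1 and h=h, OF box_bump_abs_le] by simp
  qed measurable
  have shift: "(\<integral>x. u (x + h) * ?f x \<partial>lborel) = (\<integral>x. u x * ?f (x - h) \<partial>lborel)"
    using lebesgue_integral_lborel_translate[of "\<lambda>x. u x * ?f (x - h)" h] by simp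
  have int2: "integrable lborel (\<lambda>x. u (x + h) * ?f x)"
    using integrable_lborel_translate_iff[of "\<lambda>x. u x * ?f (x - h)" h] int1 by simp
  have "(\<integral>x. (u (x + h) - u x) * ?f x \<partial>lborel) = (\<integral>x. u x * ?f (x - h) \<partial>lborel) - (\<integral>x. u x * ?f x \<partial>lborel)"
    using int0 int2 shift by (simp add: left_diff_distrib)
  also have "\<dots> = (\<integral>x. u x * (?f (x - h) - ?f x) \<partial>lborel)"
    using int0 int1 by (simp add: right_diff_distrib)
  also have "\<dots> = - (\<integral>x. (\<integral>s. u x * (indicator {0..1} s * ?D (x - s *\<^sub>R h)) \<partial>lborel) \<partial>lborel)"
    unfolding box_bump_diff_eq_integral by simp
  also have "(\<integral>x. (\<integral>s. u x * (indicator {0..1} s * ?D (x - s *\<^sub>R h)) \<partial>lborel) \<partial>lborel)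
      = (\<integral>s. (\<integral>x. u x * (indicator {0..1} s * ?D (x - s *\<^sub>R h)) \<partial>lborel) \<partial>lborel)"
    by (rule lborel_pair.Fubini_integral[symmetric]) (rule integrable_product_u)
  also have "\<dots> = (\<integral>s. - (\<integral>x. indicator {0..1} s * (g (x + s *\<^sub>R h) \<bullet> h) * ?f x \<partial>lborel) \<partial>lborel)"
  proof (rule Bochner_Integration.integral_cong[OF refl])
    fix s :: real
    \<comment> \<open>A translated bump is the bump of the translated box, so the weak gradient
      identity applies to it.\<close>
    have "(\<integral>x. u x * ?D (x - s *\<^sub>R h) \<partial>lborel) = - (\<integral>x. (g x \<bullet> h) * ?f (x - s *\<^sub>R h) \<partial>lborel)"
      using weak_direction[of n "a + s *\<^sub>R h" "b + s *\<^sub>R h" h]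
        box_bump_deriv_translate[of n a "- (s *\<^sub>R h)" b] box_bump_translate[of n a b _ "- (s *\<^sub>R h)"] by simp
    also have "(\<integral>x. (g x \<bullet> h) * ?f (x - s *\<^sub>R h) \<partial>lborel) = (\<integral>x. (g (x + s *\<^sub>R h) \<bullet> h) * ?f x \<partial>lborel)"
      using lebesgue_integral_lborel_translate[of "\<lambda>x. (g x \<bullet> h) * ?f (x - s *\<^sub>R h)" "s *\<^sub>R h"] by simp
    finally show "(\<integral>x. u x * (indicator {0..1} s * ?D (x - s *\<^sub>R h)) \<partial>lborel)
        = - (\<integral>x. indicator {0..1} s * (g (x + s *\<^sub>R h) \<bullet> h) * ?f x \<partial>lborel)"
      by (cases "s \<in> {0..1}") simp_all
  qed
  also have "\<dots> = - (\<integral>s. (\<integral>x. indicator {0..1} s * (g (x + s *\<^sub>R h) \<bullet> h) * ?f x \<partial>lborel) \<partial>lborel)"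
    by simp
  also have "(\<integral>s. (\<integral>x. indicator {0..1} s * (g (x + s *\<^sub>R h) \<bullet> h) * ?f x \<partial>lborel) \<partial>lborel)
      = (\<integral>x. (\<integral>s. indicator {0..1} s * (g (x + s *\<^sub>R h) \<bullet> h) * ?f x \<partial>lborel) \<partial>lborel)"
    by (rule lborel_pair.Fubini_integral[symmetric]) (rule integrable_product_g[OF box_bump_borel box_bump_abs_le])
  also have "\<dots> = (\<integral>x. mean_gradient h x * ?f x \<partial>lborel)"
    by (simp add: mean_gradient_def)
  finally show ?thesis by simp
qed

text \<open>The mean gradient is locally integrable by integrating out \<open>s\<close> in the
  product bound with \<open>m\<close> the indicator of the box.\<close>

lemma difference_integrable: "integrable lborel (\<lambda>x. indicator (cbox a b) x * (u (x + h) - u x - mean_gradient h x))"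
proof -
  let ?I = "indicator (cbox a b) :: 'a \<Rightarrow> real"
  have I: "\<bar>?I x\<bar> \<le> 1 * indicator (cbox a b) x" for x by simp
  have "integrable lborel (\<lambda>x. \<integral>s. indicator {0..1} s * (g (x + s *\<^sub>R h) \<bullet> h) * ?I x \<partial>lborel)"
    using lborel_pair.integrable_snd[OF integrable_product_g[OF _ I]] by simp
  then have G: "integrable lborel (\<lambda>x. ?I x * mean_gradient h x)"
    by (simp add: mean_gradient_def mult.commute)
  have "integrable lborel (\<lambda>x. u x * ?I (x - h))"
  proof (rule u_mult_integrable)
    show "\<bar>?I (x - h)\<bar> \<le> \<bar>1\<bar> * indicator (cbox (a - norm h *\<^sub>R One) (b + norm h *\<^sub>R One)) x" for x
      using translated_bound[where m="?I" and s=1 and h=h, OF I] by simp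
  qed measurable
  then have "integrable lborel (\<lambda>x. ?I x * u (x + h))"
    using integrable_lborel_translate_iff[of "\<lambda>x. u x * ?I (x - h)" h] by (simp add: mult.commute)
  then have "integrable lborel (\<lambda>x. ?I x * u (x + h) - ?I x * u x - ?I x * mean_gradient h x)"
    using u_integrable G by (intro Bochner_Integration.integrable_diff)
  then show ?thesis by (simp add: right_diff_distrib)
qed

text \<open>Dominated convergence: the bumps tend to the indicator of the open box and are bounded
  by that of the closed one.\<close>

lemma integral_box_difference_eq_0:
  "(\<integral>x. indicator (box a b) x * (u (x + h) - u x - mean_gradient h x) \<partial>lborel) = 0"
proof -
  let ?D = "\<lambda>x. u (x + h) - u x - mean_gradient h x" and ?f = "\<lambda>n. box_bump n a b"
  have zero: "(\<integral>x. ?f n x * ?D x \<partial>lborel) = 0" for n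
  proof -
    have I: "\<bar>?f n x\<bar> \<le> 1 * indicator (cbox a b) x" for x by (rule box_bump_abs_le)
    have D: "integrable lborel (\<lambda>x. ?D x * ?f n x)"
      by (rule integrable_mult_bounded_support[OF difference_integrable _ _ I]) measurable
    have "integrable lborel (\<lambda>x. \<integral>s. indicator {0..1} s * (g (x + s *\<^sub>R h) \<bullet> h) * ?f n x \<partial>lborel)"
      using lborel_pair.integrable_snd[OF integrable_product_g[OF _ I]] by simp
    then have G: "integrable lborel (\<lambda>x. mean_gradient h x * ?f n x)"
      by (simp add: mean_gradient_def)
    \<comment> \<open>Adding and subtracting the mean gradient reduces the splitting of the integral
      to the two integrability facts just obtained.\<close>
    have "(\<integral>x. ?f n x * ?D x \<partial>lborel) = (\<integral>x. (?D x * ?f n x + mean_gradient h x * ?f n x) - mean_gradient h x * ?f n x \<partial>lborel)"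
      by (simp add: mult.commute)
    also have "\<dots> = (\<integral>x. ?D x * ?f n x + mean_gradient h x * ?f n x \<partial>lborel) - (\<integral>x. mean_gradient h x * ?f n x \<partial>lborel)"
      using D G by (intro Bochner_Integration.integral_diff Bochner_Integration.integrable_add)
    also have "(\<integral>x. ?D x * ?f n x + mean_gradient h x * ?f n x \<partial>lborel) = (\<integral>x. (u (x + h) - u x) * ?f n x \<partial>lborel)"
      by (simp add: distrib_right[symmetric])
    finally show ?thesis by (simp add: integral_difference_box_bump)
  qed
  have "(\<lambda>n. \<integral>x. ?f n x * ?D x \<partial>lborel) \<longlonglongrightarrow> (\<integral>x. indicator (box a b) x * ?D x \<partial>lborel)"
  proof (rule integral_dominated_convergence)
    show "integrable lborel (\<lambda>x. \<bar>indicator (cbox a b) x * ?D x\<bar>)"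
      using difference_integrable by (rule integrable_abs)
    show "AE x in lborel. (\<lambda>n. ?f n x * ?D x) \<longlonglongrightarrow> indicator (box a b) x * ?D x"
      by (intro AE_I2 tendsto_mult box_bump_tendsto tendsto_const)
    show "AE x in lborel. norm (?f n x * ?D x) \<le> \<bar>indicator (cbox a b) x * ?D x\<bar>" for n
    proof (intro AE_I2)
      fix x
      show "norm (?f n x * ?D x) \<le> \<bar>indicator (cbox a b) x * ?D x\<bar>"
        using mult_right_mono[OF box_bump_abs_le[of n a b x], of "\<bar>?D x\<bar>"] by (simp add: abs_mult)
    qed
  qed measurable
  then show ?thesis using zero by (simp add: LIMSEQ_const_iff)
qed

lemma difference_eq_mean_gradient: "AE x in lborel. u (x + h) - u x = mean_gradient h x"
proof -
  have "integrable lborel (\<lambda>x. indicator (box a b) x * (u (x + h) - u x - mean_gradient h x))" for a b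
    using integrable_mult_indicator[OF _ difference_integrable[of a b h], of "box a b"] box_subset_cbox[of a b]
    by (simp add: mult.assoc[symmetric] indicator_inter_arith[symmetric] Int_absorb2)
  then have "AE x in lborel. u (x + h) - u x - mean_gradient h x = 0"
    using integral_box_difference_eq_0 by (intro AE_eq_0_if_integral_box_eq_0) measurable
  then show ?thesis by simp
qed

text \<open>Jensen's inequality in \<open>s\<close>, Tonelli's theorem, and translation invariance,
  which makes the inner integral independent of \<open>s\<close>. The Cauchy-Schwarz inequality
  extracts the norm of \<open>h\<close>.\<close>

lemma difference_power_le:
  assumes p: "1 \<le> p"
  shows "(\<integral>\<^sup>+x. ennreal (\<bar>u (x + h) - u x\<bar> powr p) \<partial>lborel)
           \<le> ennreal (norm h powr p) * (\<integral>\<^sup>+x. ennreal (norm (g x) powr p) \<partial>lborel)"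
proof -
  let ?G = "\<integral>\<^sup>+x. ennreal (\<bar>g x \<bullet> h\<bar> powr p) \<partial>lborel"
  have "(\<integral>\<^sup>+x. ennreal (\<bar>u (x + h) - u x\<bar> powr p) \<partial>lborel) = (\<integral>\<^sup>+x. ennreal (\<bar>mean_gradient h x\<bar> powr p) \<partial>lborel)"
    using difference_eq_mean_gradient[of h] by (intro nn_integral_cong_AE) auto
  also have "\<dots> \<le> (\<integral>\<^sup>+x. (\<integral>\<^sup>+s. indicator {0..1} s * ennreal (\<bar>g (x + s *\<^sub>R h) \<bullet> h\<bar> powr p) \<partial>lborel) \<partial>lborel)"
    unfolding mean_gradient_def by (intro nn_integral_mono powr_abs_integral_unit_interval_le p) measurable
  also have "\<dots> = (\<integral>\<^sup>+s. (\<integral>\<^sup>+x. indicator {0..1} s * ennreal (\<bar>g (x + s *\<^sub>R h) \<bullet> h\<bar> powr p) \<partial>lborel) \<partial>lborel)"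
    by (rule lborel_pair.Fubini'[symmetric]) measurable
  also have "\<dots> = (\<integral>\<^sup>+s. indicator {0..1::real} s * ?G \<partial>lborel)"
  proof (rule nn_integral_cong)
    fix s :: real
    have "(\<integral>\<^sup>+x. indicator {0..1} s * ennreal (\<bar>g (x + s *\<^sub>R h) \<bullet> h\<bar> powr p) \<partial>lborel)
        = indicator {0..1} s * (\<integral>\<^sup>+x. ennreal (\<bar>g (x + s *\<^sub>R h) \<bullet> h\<bar> powr p) \<partial>lborel)"
      by (rule nn_integral_cmult) measurable
    also have "(\<integral>\<^sup>+x. ennreal (\<bar>g (x + s *\<^sub>R h) \<bullet> h\<bar> powr p) \<partial>lborel) = ?G"
      by (rule nn_integral_lborel_translate[of "\<lambda>x. ennreal (\<bar>g x \<bullet> h\<bar> powr p)"]) measurable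
    finally show "(\<integral>\<^sup>+x. indicator {0..1} s * ennreal (\<bar>g (x + s *\<^sub>R h) \<bullet> h\<bar> powr p) \<partial>lborel) = indicator {0..1} s * ?G" .
  qed
  also have "\<dots> = ?G"
    using emeasure_lborel_Icc[of 0 1] by (simp add: nn_integral_multc)
  also have "\<dots> \<le> (\<integral>\<^sup>+x. ennreal (norm h powr p) * ennreal (norm (g x) powr p) \<partial>lborel)"
  proof (rule nn_integral_mono)
    fix x
    have "\<bar>g x \<bullet> h\<bar> powr p \<le> (norm (g x) * norm h) powr p"
      using p by (intro powr_mono2 Cauchy_Schwarz_ineq2) auto
    then show "ennreal (\<bar>g x \<bullet> h\<bar> powr p) \<le> ennreal (norm h powr p) * ennreal (norm (g x) powr p)"
      by (simp add: ennreal_mult'[symmetric] powr_mult mult.commute ennreal_leI)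
  qed
  also have "\<dots> = ennreal (norm h powr p) * (\<integral>\<^sup>+x. ennreal (norm (g x) powr p) \<partial>lborel)"
    by (rule nn_integral_cmult) measurable
  finally show ?thesis .
qed

end

section \<open>Borel representatives of Lebesgue measurable functions\<close>

lemma AE_lebesgue_reflect:
  fixes x :: "'a::euclidean_space"
  assumes "AE h in lebesgue. P h"
  shows "AE y in lebesgue. P (x - y)"
proof -
  obtain N where N: "N \<in> null_sets lebesgue" "{h. \<not> P h} \<subseteq> N"
    using assms unfolding eventually_ae_filter by auto
  have [measurable]: "(indicator N :: 'a \<Rightarrow> ennreal) \<in> borel_measurable lebesgue"
    using N by (intro borel_measurable_indicator) auto
  have "(\<integral>\<^sup>+y. indicator N (x - y) \<partial>lebesgue) = (\<integral>\<^sup>+h. indicator N h \<partial>lebesgue)"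
    by (rule nn_integral_lebesgue_reflect) measurable
  also have "\<dots> = emeasure lebesgue N"
    using N by (intro nn_integral_indicator) auto
  finally have "(\<integral>\<^sup>+y. indicator N (x - y) \<partial>lebesgue) = (0::ennreal)"
    using N by (auto simp: null_sets_def)
  moreover have "(\<lambda>y. indicator N (x - y) :: ennreal) \<in> borel_measurable lebesgue"
    by (rule borel_measurable_lebesgue_reflect) measurable
  ultimately have "AE y in lebesgue. indicator N (x - y) = (0::ennreal)"
    by (simp add: nn_integral_0_iff_AE)
  then show ?thesis
    by eventually_elim (use N(2) in \<open>auto split: split_indicator_asm\<close>)
qed

text \<open>Tonelli's theorem needs joint measurability of expressions such as u(x - h), which Borel
  representatives provide. The construction works coordinate by coordinate from the real-valued
  case.\<close>

lemma borel_version: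
  fixes f :: "'a::euclidean_space \<Rightarrow> 'b::euclidean_space"
  assumes f: "f \<in> borel_measurable lebesgue"
  obtains f' where "f' \<in> borel_measurable borel" "AE x in lebesgue. f x = f' x"
proof -
  have "\<forall>i. \<exists>f'. f' \<in> borel_measurable lborel \<and> (AE x in lborel. f x \<bullet> i = f' x)"
  proof
    fix i
    have "(\<lambda>x. f x \<bullet> i) \<in> borel_measurable lebesgue" using f by simp
    then show "\<exists>f'. f' \<in> borel_measurable lborel \<and> (AE x in lborel. f x \<bullet> i = f' x)"
      using completion_ex_borel_measurable_real by blast
  qed
  then obtain F where F: "\<And>i. F i \<in> borel_measurable lborel" "\<And>i. AE x in lborel. f x \<bullet> i = F i x"
    unfolding choice_iff by blast
  have "AE x in lborel. \<forall>i\<in>Basis. f x \<bullet> i = F i x"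
    using F(2) by (intro AE_finite_allI) auto
  then have "AE x in lborel. f x = (\<Sum>i\<in>Basis. F i x *\<^sub>R i)"
  proof eventually_elim
    case (elim x)
    have "f x = (\<Sum>i\<in>Basis. (f x \<bullet> i) *\<^sub>R i)" by (rule euclidean_representation[symmetric])
    also have "\<dots> = (\<Sum>i\<in>Basis. F i x *\<^sub>R i)" using elim by (intro sum.cong) simp_all
    finally show ?case .
  qed
  then have "AE x in lebesgue. f x = (\<Sum>i\<in>Basis. F i x *\<^sub>R i)"
    by (rule AE_completion)
  moreover have "(\<lambda>x. \<Sum>i\<in>Basis. F i x *\<^sub>R i) \<in> borel_measurable borel"
    using F(1) by (intro borel_measurable_sum borel_measurable_scaleR) auto
  ultimately show ?thesis using that by blast
qed

lemma integrable_lborel_borel_version: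
  fixes f f' :: "'a::euclidean_space \<Rightarrow> real"
  assumes "integrable lebesgue f" and [measurable]: "f' \<in> borel_measurable borel" and "AE x in lebesgue. f x = f' x"
  shows "integrable lborel f'"
proof -
  have m: "f' \<in> borel_measurable lebesgue" by (rule measurable_completion) simp
  have "integrable lebesgue f'"
    using integrable_cong_AE[OF borel_measurable_integrable[OF assms(1)] m assms(3)] assms(1) by simp
  then show ?thesis by (simp add: integrable_completion)
qed

lemma integral_lborel_borel_version:
  fixes f f' :: "'a::euclidean_space \<Rightarrow> real"
  assumes "f \<in> borel_measurable lebesgue" and [measurable]: "f' \<in> borel_measurable borel" and "AE x in lebesgue. f x = f' x"
  shows "(\<integral>x. f x \<partial>lebesgue) = (\<integral>x. f' x \<partial>lborel)"
proof -
  have m: "f' \<in> borel_measurable lebesgue" by (rule measurable_completion) simp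
  have "(\<integral>x. f x \<partial>lebesgue) = (\<integral>x. f' x \<partial>lebesgue)"
    by (rule integral_cong_AE[OF assms(1) m assms(3)])
  then show ?thesis by (simp add: integral_completion)
qed

lemma nn_integral_lborel_borel_version:
  assumes "AE x in lebesgue. f x = f' x"
  shows "(\<integral>\<^sup>+x. f x \<partial>lebesgue) = (\<integral>\<^sup>+x. f' x \<partial>lborel)"
  using nn_integral_cong_AE[OF assms] by (simp add: nn_integral_completion)

text \<open>Bumps are test functions, and the integrals involved ignore null sets, so the weak
  identity passes to the representatives.\<close>

lemma borel_weak_gradient_version:
  fixes u :: "'a::euclidean_space \<Rightarrow> real"
  assumes weak: "is_weak_gradient u g"
    and [measurable]: "u \<in> borel_measurable lebesgue" "g \<in> borel_measurable lebesgue"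
    and [measurable]: "u' \<in> borel_measurable borel" "g' \<in> borel_measurable borel"
    and u': "AE x in lebesgue. u x = u' x" and g': "AE x in lebesgue. g x = g' x"
  shows "borel_weak_gradient u' g'"
proof
  fix a b :: 'a
  have lu: "integrable (lebesgue_on (cbox a b)) u" and lg: "integrable (lebesgue_on (cbox a b)) g"
    using weak by (auto simp: is_weak_gradient_def locally_integrable_def)
  have "integrable lebesgue (\<lambda>x. indicator (cbox a b) x * u x)"
    using lu by (simp add: integrable_restrict_space)
  then show "integrable lborel (\<lambda>x. indicator (cbox a b) x * u' x)"
  proof (rule integrable_lborel_borel_version)
    show "AE x in lebesgue. indicator (cbox a b) x * u x = indicator (cbox a b) x * u' x"
      using u' by eventually_elim simp
  qed measurable
  have "integrable (lebesgue_on (cbox a b)) (\<lambda>x. norm (g x))"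
    using lg by (rule integrable_norm)
  then have "integrable lebesgue (\<lambda>x. indicator (cbox a b) x * norm (g x))"
    by (simp add: integrable_restrict_space)
  then show "integrable lborel (\<lambda>x. indicator (cbox a b) x * norm (g' x))"
  proof (rule integrable_lborel_borel_version)
    show "AE x in lebesgue. indicator (cbox a b) x * norm (g x) = indicator (cbox a b) x * norm (g' x)"
      using g' by eventually_elim simp
  qed measurable
next
  fix i a b :: 'a and n
  assume i: "i \<in> Basis"
  have f: "box_bump n a b \<in> borel_measurable lebesgue"
    and D: "(\<lambda>x. box_bump_deriv n a b x i) \<in> borel_measurable lebesgue"
    by (rule measurable_completion, simp)+
  have "(\<integral>x. u x * box_bump_deriv n a b x i \<partial>lebesgue) = (\<integral>x. u' x * box_bump_deriv n a b x i \<partial>lborel)"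
  proof (rule integral_lborel_borel_version)
    show "(\<lambda>x. u x * box_bump_deriv n a b x i) \<in> borel_measurable lebesgue"
      using assms(2) D by (rule borel_measurable_times)
    show "AE x in lebesgue. u x * box_bump_deriv n a b x i = u' x * box_bump_deriv n a b x i"
      using u' by eventually_elim simp
  qed measurable
  moreover have "(\<integral>x. (g x \<bullet> i) * box_bump n a b x \<partial>lebesgue) = (\<integral>x. (g' x \<bullet> i) * box_bump n a b x \<partial>lborel)"
  proof (rule integral_lborel_borel_version)
    show "(\<lambda>x. (g x \<bullet> i) * box_bump n a b x) \<in> borel_measurable lebesgue"
      using assms(3) f by (intro borel_measurable_times borel_measurable_inner borel_measurable_const)
    show "AE x in lebesgue. (g x \<bullet> i) * box_bump n a b x = (g' x \<bullet> i) * box_bump n a b x"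
      using g' by eventually_elim simp
  qed measurable
  moreover have "(\<integral>x. u x * box_bump_deriv n a b x i \<partial>lebesgue) = - (\<integral>x. (g x \<bullet> i) * box_bump n a b x \<partial>lebesgue)"
    using weak i test_function_box_bump[of n a b] unfolding is_weak_gradient_def by blast
  ultimately show "(\<integral>x. u' x * box_bump_deriv n a b x i \<partial>lborel) = - (\<integral>x. (g' x \<bullet> i) * box_bump n a b x \<partial>lborel)"
    by simp
qed measurable

section \<open>The Sobolev space inside the nonlocal space\<close>

lemma powr_abs_diff_le:
  fixes a b p :: real
  assumes "0 \<le> p"
  shows "\<bar>a - b\<bar> powr p \<le> 2 powr p * (\<bar>a\<bar> powr p + \<bar>b\<bar> powr p)"
proof -
  have "\<bar>a - b\<bar> powr p \<le> (2 * max \<bar>a\<bar> \<bar>b\<bar>) powr p"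
    using assms by (intro powr_mono2) auto
  also have "\<dots> = 2 powr p * max \<bar>a\<bar> \<bar>b\<bar> powr p" by (simp add: powr_mult)
  also have "\<dots> \<le> 2 powr p * (\<bar>a\<bar> powr p + \<bar>b\<bar> powr p)"
    by (rule mult_left_mono) (simp_all add: max_def)
  finally show ?thesis .
qed

text \<open>Where the minimum is \<open>norm h powr p\<close> the difference quotient bound applies.
  Otherwise the triangle inequality and translation invariance give the bound by the
  \<open>L\<^sup>p\<close> power, with constant \<open>2 powr p * 2\<close>.\<close>

lemma (in borel_weak_gradient) difference_power_le_min:
  assumes p: "1 \<le> p"
  shows "(\<integral>\<^sup>+x. ennreal (\<bar>u x - u (x - h)\<bar> powr p) \<partial>lborel)
    \<le> ennreal (min 1 (norm h powr p)) * (ennreal (2 powr p * 2) *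
        ((\<integral>\<^sup>+x. ennreal (\<bar>u x\<bar> powr p) \<partial>lborel) + (\<integral>\<^sup>+x. ennreal (norm (g x) powr p) \<partial>lborel)))"
proof -
  let ?P = "\<integral>\<^sup>+x. ennreal (\<bar>u x\<bar> powr p) \<partial>lborel" and ?Q = "\<integral>\<^sup>+x. ennreal (norm (g x) powr p) \<partial>lborel"
  let ?A = "\<integral>\<^sup>+x. ennreal (\<bar>u x - u (x - h)\<bar> powr p) \<partial>lborel"
  have 2: "1 \<le> 2 powr p * 2" using ge_one_powr_ge_zero[of 2 p] p by linarith
  show ?thesis
  proof (cases "norm h powr p \<le> 1")
    case True
    have "?A \<le> ennreal (norm h powr p) * ?Q"
      using difference_power_le[OF p, of "- h"] by (simp add: abs_minus_commute)
    also have "\<dots> \<le> ennreal (norm h powr p) * (ennreal (2 powr p * 2) * (?P + ?Q))"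
    proof (rule mult_left_mono)
      have "1 * ?Q \<le> ennreal (2 powr p * 2) * (?P + ?Q)"
        using 2 by (intro mult_mono) auto
      then show "?Q \<le> ennreal (2 powr p * 2) * (?P + ?Q)" by simp
    qed simp
    finally show ?thesis using True by (simp add: min_absorb2)
  next
    case False
    have "?A \<le> (\<integral>\<^sup>+x. ennreal (2 powr p) * (ennreal (\<bar>u x\<bar> powr p) + ennreal (\<bar>u (x - h)\<bar> powr p)) \<partial>lborel)"
    proof (rule nn_integral_mono)
      fix x
      show "ennreal (\<bar>u x - u (x - h)\<bar> powr p) \<le> ennreal (2 powr p) * (ennreal (\<bar>u x\<bar> powr p) + ennreal (\<bar>u (x - h)\<bar> powr p))"
        using powr_abs_diff_le[of p "u x" "u (x - h)"] p
        by (simp add: ennreal_mult'[symmetric] ennreal_leI flip: ennreal_plus)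
    qed
    also have "\<dots> = ennreal (2 powr p) * (?P + (\<integral>\<^sup>+x. ennreal (\<bar>u (x - h)\<bar> powr p) \<partial>lborel))"
      by (simp add: nn_integral_cmult nn_integral_add)
    also have "(\<integral>\<^sup>+x. ennreal (\<bar>u (x - h)\<bar> powr p) \<partial>lborel) = ?P"
      using nn_integral_lborel_translate[of "\<lambda>x. ennreal (\<bar>u x\<bar> powr p)" "- h"] by simp
    also have "ennreal (2 powr p) * (?P + ?P) = ennreal (2 powr p * 2) * ?P"
      by (simp add: ennreal_mult' mult.assoc mult_2)
    also have "\<dots> \<le> ennreal (2 powr p * 2) * (?P + ?Q)" by (intro mult_left_mono) auto
    finally show ?thesis using False by simp
  qed
qed

text \<open>With \<open>h = x - y\<close> and Tonelli's theorem the seminorm becomes an integral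
  over \<open>h\<close> of \<nu> against the \<open>p\<close>-th power of the
  \<open>L\<^sup>p\<close> norm of a difference, which the preceding bound controls.\<close>

lemma nonlocal_power_le_sobolev:
  fixes u :: "'a::euclidean_space \<Rightarrow> real"
  assumes p: "1 \<le> p" and [measurable]: "\<nu> \<in> borel_measurable lebesgue"
    and u: "u \<in> Lp_space p" and g: "g \<in> Lp_space p" and weak: "is_weak_gradient u g"
  shows "nonlocal_power p \<nu> u \<le> ennreal (2 powr p * 2) * (Lp_power p u + Lp_power p g) *
           (\<integral>\<^sup>+h. ennreal (min 1 (norm h powr p) * \<nu> h) \<partial>lebesgue)"
proof -
  have um: "u \<in> borel_measurable lebesgue" and gm: "g \<in> borel_measurable lebesgue"
    using u g by (auto simp: Lp_space_def)
  obtain u' where [measurable]: "u' \<in> borel_measurable borel" and u': "AE x in lebesgue. u x = u' x"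
    using borel_version[OF um] .
  obtain g' where [measurable]: "g' \<in> borel_measurable borel" and g': "AE x in lebesgue. g x = g' x"
    using borel_version[OF gm] .
  obtain k where [measurable]: "k \<in> borel_measurable borel" and k: "AE h in lebesgue. \<nu> h = k h"
    using borel_version[OF \<open>\<nu> \<in> borel_measurable lebesgue\<close>] .
  interpret borel_weak_gradient u' g'
    by (rule borel_weak_gradient_version[OF weak um gm _ _ u' g']) measurable
  let ?C = "ennreal (2 powr p * 2) * (Lp_power p u + Lp_power p g)"
  have P: "Lp_power p u = (\<integral>\<^sup>+x. ennreal (\<bar>u' x\<bar> powr p) \<partial>lborel)"
    unfolding Lp_power_def by (rule nn_integral_lborel_borel_version) (use u' in eventually_elim, simp)
  have Q: "Lp_power p g = (\<integral>\<^sup>+x. ennreal (norm (g' x) powr p) \<partial>lborel)"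
    unfolding Lp_power_def by (rule nn_integral_lborel_borel_version) (use g' in eventually_elim, simp)
  \<comment> \<open>The inner integral is rewritten for every \<open>x\<close>, with
    \<open>u' x\<close> in place of \<open>u x\<close>; that last replacement is made almost
    everywhere in the outer integral.\<close>
  have inner: "(\<integral>\<^sup>+y. ennreal (\<bar>u' x - u y\<bar> powr p * \<nu> (x - y)) \<partial>lebesgue)
      = (\<integral>\<^sup>+h. ennreal (\<bar>u' x - u' (x - h)\<bar> powr p * k h) \<partial>lborel)" for x
  proof -
    have m: "(\<lambda>y. ennreal (\<bar>u' x - u' (x - y)\<bar> powr p * k y)) \<in> borel_measurable lebesgue"
      by (rule measurable_completion) measurable
    have "(\<integral>\<^sup>+y. ennreal (\<bar>u' x - u y\<bar> powr p * \<nu> (x - y)) \<partial>lebesgue)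
        = (\<integral>\<^sup>+y. ennreal (\<bar>u' x - u' (x - (x - y))\<bar> powr p * k (x - y)) \<partial>lebesgue)"
    proof (rule nn_integral_cong_AE)
      show "AE y in lebesgue. ennreal (\<bar>u' x - u y\<bar> powr p * \<nu> (x - y)) = ennreal (\<bar>u' x - u' (x - (x - y))\<bar> powr p * k (x - y))"
        using u' AE_lebesgue_reflect[OF k, of x] by eventually_elim simp
    qed
    also have "\<dots> = (\<integral>\<^sup>+y. ennreal (\<bar>u' x - u' (x - y)\<bar> powr p * k y) \<partial>lebesgue)"
      using m by (rule nn_integral_lebesgue_reflect)
    finally show ?thesis by (simp add: nn_integral_completion)
  qed
  have "nonlocal_power p \<nu> u = (\<integral>\<^sup>+x. (\<integral>\<^sup>+h. ennreal (\<bar>u' x - u' (x - h)\<bar> powr p * k h) \<partial>lborel) \<partial>lborel)"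
    unfolding nonlocal_power_def
    by (rule nn_integral_lborel_borel_version) (use u' in eventually_elim, simp only: inner)
  also have "\<dots> = (\<integral>\<^sup>+h. (\<integral>\<^sup>+x. ennreal (\<bar>u' x - u' (x - h)\<bar> powr p * k h) \<partial>lborel) \<partial>lborel)"
    by (rule lborel_pair.Fubini'[symmetric]) measurable
  also have "\<dots> \<le> (\<integral>\<^sup>+h. ?C * ennreal (min 1 (norm h powr p) * k h) \<partial>lborel)"
  proof (rule nn_integral_mono)
    fix h
    have "(\<integral>\<^sup>+x. ennreal (\<bar>u' x - u' (x - h)\<bar> powr p * k h) \<partial>lborel)
        = (\<integral>\<^sup>+x. ennreal (\<bar>u' x - u' (x - h)\<bar> powr p) \<partial>lborel) * ennreal (k h)"
      by (simp add: ennreal_mult' nn_integral_multc)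
    also have "\<dots> \<le> (ennreal (min 1 (norm h powr p)) * ?C) * ennreal (k h)"
      unfolding P Q by (intro mult_right_mono difference_power_le_min p) simp
    also have "\<dots> = ?C * ennreal (min 1 (norm h powr p) * k h)"
      by (subst ennreal_mult') (simp_all only: min.bounded_iff zero_le_one powr_ge_zero mult_ac simp_thms)
    finally show "(\<integral>\<^sup>+x. ennreal (\<bar>u' x - u' (x - h)\<bar> powr p * k h) \<partial>lborel) \<le> ?C * ennreal (min 1 (norm h powr p) * k h)" .
  qed
  also have "\<dots> = ?C * (\<integral>\<^sup>+h. ennreal (min 1 (norm h powr p) * k h) \<partial>lborel)"
    by (rule nn_integral_cmult) measurable
  also have "(\<integral>\<^sup>+h. ennreal (min 1 (norm h powr p) * k h) \<partial>lborel)
      = (\<integral>\<^sup>+h. ennreal (min 1 (norm h powr p) * \<nu> h) \<partial>lebesgue)"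
    by (rule nn_integral_lborel_borel_version[symmetric]) (use k in eventually_elim, simp)
  finally show ?thesis .
qed

lemma sobolev_space_embeds_nonlocal_space:
  fixes \<nu> :: "'a::euclidean_space \<Rightarrow> real"
  assumes p: "1 \<le> p" and \<nu>: "\<nu> \<in> borel_measurable lebesgue"
    and int: "(\<integral>\<^sup>+h. ennreal (min 1 (norm h powr p) * \<nu> h) \<partial>lebesgue) < top"
  shows "continuous_embedding (sobolev_space p) (sobolev_norm p) (nonlocal_space p \<nu>) (nonlocal_norm p \<nu>)"
proof -
  obtain N where N: "(\<integral>\<^sup>+h. ennreal (min 1 (norm h powr p) * \<nu> h) \<partial>lebesgue) = ennreal N" "0 \<le> N"
    using int by (cases "\<integral>\<^sup>+h. ennreal (min 1 (norm h powr p) * \<nu> h) \<partial>lebesgue") auto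
  \<comment> \<open>The 1 accounts for the \<open>L\<^sup>p\<close> part of the nonlocal norm, the
    rest for the seminorm.\<close>
  define M where "M = 1 + 2 powr p * 2 * N"
  have M: "0 \<le> M" using N by (simp add: M_def)
  have "nonlocal_power p \<nu> u < top \<and> nonlocal_norm p \<nu> u \<le> M powr (1 / p) * sobolev_norm p u \<and> u \<in> Lp_space p"
    if u: "u \<in> sobolev_space p" for u :: "'a \<Rightarrow> real"
  proof -
    let ?g = "weak_gradient p u" and ?P = "Lp_power p u" and ?I = "nonlocal_power p \<nu> u"
    have "\<exists>g. g \<in> Lp_space p \<and> is_weak_gradient u g" using u by (auto simp: sobolev_space_def)
    from someI_ex[OF this] have g: "?g \<in> Lp_space p" "is_weak_gradient u ?g"
      by (simp_all add: weak_gradient_def)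
    have Lp: "u \<in> Lp_space p" using u by (simp add: sobolev_space_def)
    let ?S = "?P + Lp_power p ?g"
    have fin: "?S < top" using Lp g(1) by (simp add: Lp_space_def)
    have "?I \<le> ennreal (2 powr p * 2) * ?S * ennreal N"
      using nonlocal_power_le_sobolev[OF p \<nu> Lp g] N by simp
    also have "\<dots> = ennreal (2 powr p * 2 * N) * ?S"
      using N by (simp add: ennreal_mult' mult_ac)
    finally have I: "?I \<le> ennreal (2 powr p * 2 * N) * ?S" .
    also have "\<dots> < top" using fin by (simp add: ennreal_mult_less_top)
    finally have I_fin: "?I < top" .
    have "?P + ?I \<le> ?S + ennreal (2 powr p * 2 * N) * ?S" using I by (intro add_mono) auto
    also have "\<dots> = ennreal M * ?S"
      using N by (simp add: M_def distrib_right)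
    finally have "enn2real (?P + ?I) \<le> enn2real (ennreal M * ?S)"
      using fin by (intro enn2real_mono) (auto simp: ennreal_mult_less_top)
    also have "\<dots> = M * enn2real ?S" using M by (simp add: enn2real_mult)
    finally have "enn2real (?P + ?I) powr (1 / p) \<le> (M * enn2real ?S) powr (1 / p)"
      using p by (intro powr_mono2) auto
    also have "\<dots> = M powr (1 / p) * enn2real ?S powr (1 / p)"
      using M by (simp add: powr_mult)
    finally show ?thesis using I_fin Lp by (simp add: nonlocal_norm_def sobolev_norm_def)
  qed
  then show ?thesis
    unfolding continuous_embedding_def nonlocal_space_def by blast
qed

section \<open>Composition of embeddings and conclusion\<close>

lemma continuous_embedding_trans:
  assumes "continuous_embedding X nX Y nY" "continuous_embedding Y nY Z nZ" and nn: "\<And>u. 0 \<le> nY u"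
  shows "continuous_embedding X nX Z nZ"
proof -
  obtain C D where C: "\<And>u. u \<in> X \<Longrightarrow> nY u \<le> C * nX u" and D: "\<And>u. u \<in> Y \<Longrightarrow> nZ u \<le> D * nY u"
    and sub: "X \<subseteq> Y" "Y \<subseteq> Z"
    using assms(1,2) unfolding continuous_embedding_def by blast
  \<comment> \<open>The constant of an embedding carries no sign; with the absolute value and a
    nonnegative middle norm the bounds compose.\<close>
  have "nZ u \<le> (\<bar>D\<bar> * C) * nX u" if "u \<in> X" for u
  proof -
    have "nZ u \<le> D * nY u" using D sub that by blast
    also have "\<dots> \<le> \<bar>D\<bar> * nY u" using nn by (intro mult_right_mono) auto
    also have "\<dots> \<le> \<bar>D\<bar> * (C * nX u)" using C[OF that] by (intro mult_left_mono) auto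
    finally show ?thesis by simp
  qed
  then show ?thesis using sub unfolding continuous_embedding_def by blast
qed

theorem corollary3p13:
  fixes \<nu> :: "'a::euclidean_space \<Rightarrow> real" and p \<theta> c :: real and \<psi> :: "ennreal \<Rightarrow> ennreal"
  assumes "1 \<le> p"
    and "\<And>h. h \<noteq> 0 \<Longrightarrow> 0 \<le> \<nu> h"
    and "\<nu> \<in> borel_measurable (lebesgue_on (UNIV - {0}))"
    and "(\<integral>\<^sup>+h. ennreal (min 1 (norm h powr p) * \<nu> h) \<partial>lebesgue_on (UNIV - {0})) < top"
    and "bij_betw (potential p \<nu>) {0..} {0..}"
    and "young_function (extend_top (\<lambda>t. phi p \<nu> (t powr (1 / p))))"
    and "0 < \<theta>"
    and "\<And>s t. 0 \<le> s \<Longrightarrow> s \<le> t \<Longrightarrow> 0 < t \<Longrightarrow> phi p \<nu> (\<theta> * s / t) \<le> phi p \<nu> s / phi p \<nu> t"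
    and "young_function \<psi>"
    and "0 < c"
    and "\<And>t::real. 0 < t \<Longrightarrow> \<psi> (ennreal (c * t)) \<le> ennreal (max (t powr p) (phi p \<nu> t))"
  shows "continuous_embedding (nonlocal_space p \<nu>) (nonlocal_norm p \<nu>)
           (orlicz_space \<psi>) (luxemburg_norm \<psi>) \<and>
         continuous_embedding (sobolev_space p) (sobolev_norm p)
           (orlicz_space \<psi> :: ('a \<Rightarrow> real) set) (luxemburg_norm \<psi>)"
proof -
  \<comment> \<open>The hypotheses constrain \<nu> only away from the origin. Setting the value at 0
    to 0 gives a kernel nonnegative and measurable everywhere, with the same \<open>nu_star\<close>,
    \<open>nu_sharp\<close> and seminorm.\<close>
  define k where "k h = (if h = 0 then 0 else \<nu> h)" for h
  have eq: "\<nu> h = k h" if "h \<noteq> 0" for h using that by (simp add: k_def)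
  have k_nonneg: "0 \<le> k h" for h using assms(2) by (simp add: k_def)
  have k_ind: "k h = \<nu> h * indicator (UNIV - {0}) h" for h by (simp add: k_def)
  have k_meas: "k \<in> borel_measurable lebesgue"
    using assms(3) by (subst (asm) borel_measurable_restrict_space_iff) (simp_all add: k_ind[abs_def] mult.commute)
  have "(\<integral>\<^sup>+h. ennreal (min 1 (norm h powr p) * k h) \<partial>lebesgue)
      = (\<integral>\<^sup>+h. ennreal (min 1 (norm h powr p) * \<nu> h) \<partial>lebesgue_on (UNIV - {0}))"
    by (subst nn_integral_restrict_space) (auto intro!: nn_integral_cong simp: k_def split: split_indicator)
  then have k_int: "(\<integral>\<^sup>+h. ennreal (min 1 (norm h powr p) * k h) \<partial>lebesgue) < top"
    using assms(4) by simp
  have star: "nu_star \<nu> = nu_star k"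
    by (intro ext) (simp add: nu_star_def eq cong: conj_cong)
  have sharp: "nu_sharp \<nu> = nu_sharp k"
    unfolding nu_sharp_def star by (intro ext nn_integral_cong) (auto simp: eq split: split_indicator)
  have nl: "nonlocal_power p \<nu> u = nonlocal_power p k u" for u
  proof -
    \<comment> \<open>On the diagonal the difference vanishes, so the kernel's value at 0 does not
      enter.\<close>
    have "\<bar>u x - u y\<bar> powr p * \<nu> (x - y) = \<bar>u x - u y\<bar> powr p * k (x - y)" for x y
      by (cases "x = y") (auto simp: eq)
    then show ?thesis unfolding nonlocal_power_def by (simp only:)
  qed
  let ?K = "max 1 (1 / phi p \<nu> (\<theta> / 2))"
  interpret nonlocal_growth p ?K k "phi p \<nu>"
  proof
    show "emeasure lebesgue {h. h \<noteq> 0 \<and> k h > s} < top" if "s > 0" for s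
      using k_meas k_nonneg k_int that \<open>1 \<le> p\<close> by (intro emeasure_superlevel_finite) auto
    show "ennreal (phi p \<nu> t * t powr - p) \<le> nu_sharp k (1 / phi p \<nu> t)" if "0 < t" for t
      using nu_sharp_inverse_phi[OF assms(1,5) that] by (simp add: sharp)
    show "phi p \<nu> (2 * t) \<le> ?K * phi p \<nu> t" if "0 \<le> t" for t
      using assms(1,5,6,7,8) that by (rule phi_double_le)
  qed (use assms(1) k_meas k_nonneg phi_mono[OF assms(1,5,6)] phi_pos[OF assms(1,5)] phi_double[OF assms(1,5,6)]
      in \<open>simp_all add: phi_def[of _ _ 0]\<close>)
  have spaces: "nonlocal_space p k = nonlocal_space p \<nu>" "nonlocal_norm p k = nonlocal_norm p \<nu>"
    by (auto simp: nonlocal_space_def nonlocal_norm_def nl)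
  have "\<psi> 0 = 0" using assms(9) by (simp add: young_function_def)
  then have *: "continuous_embedding (nonlocal_space p \<nu>) (nonlocal_norm p \<nu>) (orlicz_space \<psi>) (luxemburg_norm \<psi>)"
    using nonlocal_space_embeds_orlicz_space[OF assms(10) _ assms(11)] by (simp add: spaces)
  \<comment> \<open>The second embedding factors through the nonlocal space.\<close>
  have "continuous_embedding (sobolev_space p) (sobolev_norm p) (nonlocal_space p \<nu>) (nonlocal_norm p \<nu>)"
    using sobolev_space_embeds_nonlocal_space[OF assms(1) k_meas k_int] by (simp add: spaces)
  then have "continuous_embedding (sobolev_space p) (sobolev_norm p) (orlicz_space \<psi> :: ('a \<Rightarrow> real) set) (luxemburg_norm \<psi>)"
    using * by (rule continuous_embedding_trans) (simp add: nonlocal_norm_def)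
  with * show ?thesis by blast
qed

end
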